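(* Let $H^*$ be a finite-dimensional graded commutative algebra over a field of characteristic zero, and let $m=m_3+m_4+\cdots$ and $m'=m_3'+m_4'+\cdots$ be the Maurer--Cartan elements of $\mathfrak g=\mathfrak g_{H^*}$ corresponding to two minimal $C_\infty$-algebra enhancements of $H^*$ that are isotopic modulo $3$. Let $p=p_2+p_3+\cdots\in\mathcal F^1\mathfrak g^0$, $p_i\in C_{\mathrm{Harr}}^{i,1-i}(H^*,H^* )$, satisfy $e^{\operatorname{ad}_p}*m\equiv m'\pmod{\mathcal F^3}$; in particular $m_3'=m_3-\delta p_2$. Then the cochain $$\widetilde\kappa_4(p_2;m,m')=m_4-m_4'+[p_2,m_3]-\tfrac12[p_2,\delta p_2]\ \in\ C_{\mathrm{Harr}}^{4,-2}(H^*,H^* )$$ is a Harrison cocycle.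
   Context: $C_{\mathrm{Harr}}^{n,j}(H^*,H^* )$ is the space of Harrison cochains: linear maps $(H^* )^{\otimes n}\to H^*$ of internal degree $j$ vanishing on all signed shuffle products of two nonempty tensors (signs with respect to the shifted degrees on $sH$, $(sH)^i=H^{i+1}$). $\mathfrak g_{H^*}=\prod_{n\ge2}C_{\mathrm{Harr}}^{n,*}(H^*,H^* )$ is the DGLA in which $f\in C_{\mathrm{Harr}}^{n,j}$ has degree $n+j-1$, with Gerstenhaber bracket $[f,g]=f\circ g-(-1)^{|f||g|}g\circ f$ (after suspension, the commutator of coderivations of $T^c(sH)$) and differential $\delta=[m_2,-]$, $m_2$ the multiplication. It is complete for the filtration $\mathcal F^p\mathfrak g=\prod_{n\ge p+1}C_{\mathrm{Harr}}^{n,*}$. A Harrison cocycle is a cochain killed by $\delta$. A minimal $C_\infty$-algebra enhancement $(H^*,0,m_2,m_3,\dots)$ corresponds to $m=m_3+m_4+\cdots$ with $m_n\in C_{\mathrm{Harr}}^{n,2-n}$ and $\delta m+\frac12[m,m]=0$. The gauge action of $p\in\mathcal F^1\mathfrak g^0$ is $e^{\operatorname{ad}_p}*m=e^{\operatorname{ad}_p}(m)-\sum_{j\ge0}\frac{(\operatorname{ad}_p)^j}{(j+1)!}(\delta p)$. Two enhancements are isotopic modulo $k$ if there is a $C_\infty$-isotopy (a $C_\infty$-morphism with linear part $\mathrm{Id}$) transporting the first to a structure agreeing with the second in all arities $\le k$; equivalently, there exists $p\in\mathcal F^1\mathfrak g^0$ with $e^{\operatorname{ad}_p}*m\equiv m'\pmod{\mathcal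 F^k}$. *)

theory Defs
  imports Complex_Main "HOL-Library.Function_Algebras" "HOL-Library.Groups_Big_Fun"
begin

section \<open>Graded commutative algebras\<close>

text \<open>The underlying vector space is the whole type \<open>'a\<close>; \<open>grd A i\<close> is the subspace of
  homogeneous elements of (cohomological) degree \<open>i\<close>.\<close>

record ('k, 'a) graded_algebra =
  scl :: "'k \<Rightarrow> 'a \<Rightarrow> 'a"
  grd :: "int \<Rightarrow> 'a set"
  mul :: "'a \<Rightarrow> 'a \<Rightarrow> 'a"

text \<open>\<open>sgn_pow k x\<close> is \<open>(-1)^k x\<close>.\<close>

definition sgn_pow :: "int \<Rightarrow> 'b::ab_group_add \<Rightarrow> 'b" where
  "sgn_pow k x = (if even k then x else - x)"

definition homogeneous_decomp ::
    "('k, 'a::ab_group_add) graded_algebra \<Rightarrow> 'a \<Rightarrow> (int \<Rightarrow> 'a) \<Rightarrow> bool" where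
  "homogeneous_decomp A x c \<longleftrightarrow>
     (\<forall>i. c i \<in> grd A i) \<and> finite {i. c i \<noteq> 0} \<and> x = (\<Sum>i | c i \<noteq> 0. c i)"

locale fd_graded_comm_algebra = vector_space "scl A"
  for A :: "('k::field, 'a::ab_group_add) graded_algebra" +
  assumes finite_dim: "\<exists>B. finite B \<and> span B = UNIV"
    and grd_subspace: "\<And>i. subspace (grd A i)"
    and grd_direct_sum: "\<And>x. \<exists>!c. homogeneous_decomp A x c"
    and mul_linear_right: "\<And>x. Vector_Spaces.linear (scl A) (scl A) (\<lambda>y. mul A x y)"
    and mul_linear_left: "\<And>y. Vector_Spaces.linear (scl A) (scl A) (\<lambda>x. mul A x y)"
    and mul_degree: "\<And>i j x y. x \<in> grd A i \<Longrightarrow> y \<in> grd A j \<Longrightarrow> mul A x y \<in> grd A (i + j)"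
    and mul_assoc: "\<And>x y z. mul A (mul A x y) z = mul A x (mul A y z)"
    and mul_graded_comm:
      "\<And>i j x y. x \<in> grd A i \<Longrightarrow> y \<in> grd A j \<Longrightarrow> mul A x y = sgn_pow (i * j) (mul A y x)"

definition component :: "('k, 'a::ab_group_add) graded_algebra \<Rightarrow> int \<Rightarrow> 'a \<Rightarrow> 'a" where
  "component A i x = (THE c. homogeneous_decomp A x c) i"

text \<open>The linear operator multiplying a homogeneous element of degree \<open>i\<close> by \<open>(-1)^(s i)\<close>.
  Koszul signs are written with it, so that they make sense on all of \<open>H\<close>.\<close>

definition sign_twist ::
    "('k, 'a::ab_group_add) graded_algebra \<Rightarrow> (int \<Rightarrow> int) \<Rightarrow> 'a \<Rightarrow> 'a" where
  "sign_twist A s x = Sum_any (\<lambda>i. sgn_pow (s i) (component A i x))"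

section \<open>Harrison cochains\<close>

text \<open>A linear map from the \<open>n\<close>-fold tensor power of \<open>H\<close> to \<open>H\<close> is represented by the
  corresponding multilinear function on lists of length \<open>n\<close>, extended by \<open>0\<close> to lists of any
  other length.\<close>

type_synonym 'a cochain = "'a list \<Rightarrow> 'a"

definition multilinear ::
    "('k::field, 'a::ab_group_add) graded_algebra \<Rightarrow> nat \<Rightarrow> 'a cochain \<Rightarrow> bool" where
  "multilinear A n f \<longleftrightarrow>
     (\<forall>xs. length xs \<noteq> n \<longrightarrow> f xs = 0) \<and>
     (\<forall>xs i. length xs = n \<and> i < n \<longrightarrow>
        Vector_Spaces.linear (scl A) (scl A) (\<lambda>x. f (xs[i := x])))"

definition has_internal_degree ::
    "('k, 'a) graded_algebra \<Rightarrow> nat \<Rightarrow> int \<Rightarrow> 'a cochain \<Rightarrow> bool" where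
  "has_internal_degree A n j f \<longleftrightarrow>
     (\<forall>xs ds. length xs = n \<and> list_all2 (\<lambda>x d. x \<in> grd A d) xs ds \<longrightarrow>
        f xs \<in> grd A (sum_list ds + j))"

text \<open>With \<open>s : H \<rightarrow> sH\<close> the suspension, a map \<open>f\<close> on the \<open>n\<close>-fold tensor power of \<open>H\<close>
  corresponds to the map \<open>F\<close> on the \<open>n\<close>-fold tensor power of \<open>sH\<close> determined by
  \<open>F (s \<otimes> \<dots> \<otimes> s) = s f\<close>.  By the Koszul rule
  \<open>(s \<otimes> \<dots> \<otimes> s) (x\<^sub>1 \<otimes> \<dots> \<otimes> x\<^sub>n) = (-1)^(\<Sum>\<^sub>k (n - k) |x\<^sub>k|) s x\<^sub>1 \<otimes> \<dots> \<otimes> s x\<^sub>n\<close>, hence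
  \<open>F (s x\<^sub>1, \<dots>, s x\<^sub>n) = (-1)^(\<Sum>\<^sub>k (n - k) |x\<^sub>k|) s f (x\<^sub>1, \<dots>, x\<^sub>n)\<close>.
  Elements of \<open>sH\<close> are written as elements of \<open>H\<close>, the degree being lowered by one.
  The passage from \<open>f\<close> to \<open>F\<close> is an involution, so the same operator desuspends.
  Positions are counted from \<open>0\<close> below.\<close>

definition suspend :: "('k, 'a::ab_group_add) graded_algebra \<Rightarrow> 'a cochain \<Rightarrow> 'a cochain" where
  "suspend A f xs =
     f (map (\<lambda>k. sign_twist A (\<lambda>d. (int (length xs) - 1 - int k) * d) (xs ! k)) [0..<length xs])"

text \<open>\<open>shuffle_eval F u v\<close> is the value of \<open>F\<close> on the signed shuffle product of the tensors \<open>u\<close>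
  and \<open>v\<close>, whose entries are pairs of an element of \<open>H\<close> and its degree in \<open>H\<close>. It follows
  \<open>(x \<otimes> u) * (y \<otimes> v) = x \<otimes> (u * (y \<otimes> v)) + (-1)^(|y| (|x| + |u|)) y \<otimes> ((x \<otimes> u) * v)\<close>
  with degrees taken in \<open>sH\<close>.\<close>

fun shuffle_eval ::
    "('a list \<Rightarrow> 'b::ab_group_add) \<Rightarrow> ('a \<times> int) list \<Rightarrow> ('a \<times> int) list \<Rightarrow> 'b" where
  "shuffle_eval F [] v = F (map fst v)"
| "shuffle_eval F (x # u) [] = F (map fst (x # u))"
| "shuffle_eval F (x # u) (y # v) =
     shuffle_eval (\<lambda>w. F (fst x # w)) u (y # v) +
     sgn_pow ((snd y - 1) * (\<Sum>z\<leftarrow>x # u. snd z - 1))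
       (shuffle_eval (\<lambda>w. F (fst y # w)) (x # u) v)"

definition vanishes_on_shuffles ::
    "('k, 'a::ab_group_add) graded_algebra \<Rightarrow> nat \<Rightarrow> 'a cochain \<Rightarrow> bool" where
  "vanishes_on_shuffles A n F \<longleftrightarrow>
     (\<forall>u v. u \<noteq> [] \<and> v \<noteq> [] \<and> length u + length v = n \<and>
        (\<forall>(x, d) \<in> set u \<union> set v. x \<in> grd A d) \<longrightarrow> shuffle_eval F u v = 0)"

definition harrison_cochains ::
    "('k::field, 'a::ab_group_add) graded_algebra \<Rightarrow> nat \<Rightarrow> int \<Rightarrow> 'a cochain set" where
  "harrison_cochains A n j =
     {f. multilinear A n f \<and> has_internal_degree A n j f \<and>
         vanishes_on_shuffles A n (suspend A f)}"

section \<open>The Gerstenhaber bracket\<close>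

text \<open>Operations on homogeneous cochains take the bidegrees \<open>(n, j)\<close> (arity, internal degree)
  of their arguments as parameters; \<open>total_degree\<close> is the degree in the DGLA.\<close>

definition total_degree :: "nat \<times> int \<Rightarrow> int" where
  "total_degree q = int (fst q) + snd q - 1"

text \<open>For suspended maps \<open>F\<close>, \<open>G\<close> of arities \<open>a\<close>, \<open>b\<close>, with \<open>G\<close> of degree \<open>e\<close>: the composite of
  \<open>F\<close> with the coderivation \<open>\<Sum>\<^sub>i 1 \<otimes> \<dots> \<otimes> 1 \<otimes> G \<otimes> 1 \<otimes> \<dots> \<otimes> 1\<close> of the tensor coalgebra on
  \<open>sH\<close>.\<close>

definition coderivation_comp ::
    "('k, 'a::ab_group_add) graded_algebra \<Rightarrow> nat \<Rightarrow> nat \<Rightarrow> int \<Rightarrow> 'a cochain \<Rightarrow> 'a cochain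
       \<Rightarrow> 'a cochain" where
  "coderivation_comp A a b e F G xs =
     (if Suc (length xs) = a + b
      then \<Sum>i<a. F (map (sign_twist A (\<lambda>d. e * (d - 1))) (take i xs)
                     @ [G (take b (drop i xs))] @ drop (i + b) xs)
      else 0)"

definition circ ::
    "('k, 'a::ab_group_add) graded_algebra \<Rightarrow> nat \<times> int \<Rightarrow> nat \<times> int \<Rightarrow> 'a cochain \<Rightarrow> 'a cochain
       \<Rightarrow> 'a cochain" where
  "circ A q r f g =
     suspend A (coderivation_comp A (fst q) (fst r) (total_degree r) (suspend A f) (suspend A g))"

definition bracket ::
    "('k, 'a::ab_group_add) graded_algebra \<Rightarrow> nat \<times> int \<Rightarrow> nat \<times> int \<Rightarrow> 'a cochain \<Rightarrow> 'a cochain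
       \<Rightarrow> 'a cochain" where
  "bracket A q r f g =
     circ A q r f g - sgn_pow (total_degree q * total_degree r) (circ A r q g f)"

definition mul_cochain :: "('k, 'a::zero) graded_algebra \<Rightarrow> 'a cochain" where
  "mul_cochain A xs = (case xs of [x, y] \<Rightarrow> mul A x y | _ \<Rightarrow> 0)"

definition harrison_diff ::
    "('k, 'a::ab_group_add) graded_algebra \<Rightarrow> nat \<times> int \<Rightarrow> 'a cochain \<Rightarrow> 'a cochain" where
  "harrison_diff A q f = bracket A (2, 0) q (mul_cochain A) f"

definition harrison_cocycles ::
    "('k::field, 'a::ab_group_add) graded_algebra \<Rightarrow> nat \<Rightarrow> int \<Rightarrow> 'a cochain set" where
  "harrison_cocycles A n j = {f \<in> harrison_cochains A n j. harrison_diff A (n, j) f = 0}"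

section \<open>The complete DGLA of Harrison cochains\<close>

text \<open>An element of the product over all arities is a function of the arity \<open>n\<close>, zero for
  \<open>n < 2\<close>.  \<open>filtration A d p\<close> is the degree \<open>d\<close> part of the \<open>p\<close>-th filtration step; its arity
  \<open>n\<close> component has internal degree \<open>d + 1 - n\<close>.\<close>

type_synonym 'a product_cochain = "nat \<Rightarrow> 'a cochain"

definition filtration ::
    "('k::field, 'a::ab_group_add) graded_algebra \<Rightarrow> int \<Rightarrow> nat \<Rightarrow> 'a product_cochain set" where
  "filtration A d p =
     {F. \<forall>n. if 2 \<le> n \<and> p + 1 \<le> n then F n \<in> harrison_cochains A n (d + 1 - int n) else F n = 0}"

definition dgla_bracket ::
    "('k, 'a::ab_group_add) graded_algebra \<Rightarrow> int \<Rightarrow> int \<Rightarrow> 'a product_cochain \<Rightarrow> 'a product_cochain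
       \<Rightarrow> 'a product_cochain" where
  "dgla_bracket A d e F G n =
     (\<Sum>(a, b) | 2 \<le> a \<and> 2 \<le> b \<and> a + b = n + 1.
        bracket A (a, d + 1 - int a) (b, e + 1 - int b) (F a) (G b))"

definition mul_element :: "('k, 'a::ab_group_add) graded_algebra \<Rightarrow> 'a product_cochain" where
  "mul_element A n = (if n = 2 then mul_cochain A else 0)"

definition dgla_diff ::
    "('k, 'a::ab_group_add) graded_algebra \<Rightarrow> int \<Rightarrow> 'a product_cochain \<Rightarrow> 'a product_cochain" where
  "dgla_diff A d F = dgla_bracket A 1 d (mul_element A) F"

definition scale_cochain :: "('k, 'a) graded_algebra \<Rightarrow> 'k \<Rightarrow> 'a cochain \<Rightarrow> 'a cochain" where
  "scale_cochain A c f xs = scl A c (f xs)"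

definition scale_product ::
    "('k, 'a) graded_algebra \<Rightarrow> 'k \<Rightarrow> 'a product_cochain \<Rightarrow> 'a product_cochain" where
  "scale_product A c F n = scale_cochain A c (F n)"

text \<open>Minimal \<open>C\<^sub>\<infinity>\<close>-algebra enhancements of \<open>A\<close>, as Maurer--Cartan elements
  \<open>m = m\<^sub>3 + m\<^sub>4 + \<dots>\<close>.\<close>

definition minimal_Cinf_enhancement ::
    "('k::field, 'a::ab_group_add) graded_algebra \<Rightarrow> 'a product_cochain \<Rightarrow> bool" where
  "minimal_Cinf_enhancement A m \<longleftrightarrow>
     m \<in> filtration A 1 2 \<and>
     dgla_diff A 1 m + scale_product A (1 / 2) (dgla_bracket A 1 1 m m) = 0"

text \<open>For \<open>p\<close> of degree \<open>0\<close> and \<open>m\<close> of degree \<open>1\<close>.  The series converge for the filtration: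
  on each list of arguments only finitely many terms are nonzero, since bracketing with \<open>p\<close>
  raises the arity.\<close>

definition gauge_action ::
    "('k::field_char_0, 'a::ab_group_add) graded_algebra \<Rightarrow> 'a product_cochain \<Rightarrow> 'a product_cochain
       \<Rightarrow> 'a product_cochain" where
  "gauge_action A p m = (\<lambda>n xs.
     Sum_any (\<lambda>j. scl A (1 / fact j) ((dgla_bracket A 0 1 p ^^ j) m n xs)) -
     Sum_any (\<lambda>j. scl A (1 / fact (j + 1)) ((dgla_bracket A 0 1 p ^^ j) (dgla_diff A 0 p) n xs)))"

definition cong_mod_filtration ::
    "('k::field, 'a::ab_group_add) graded_algebra \<Rightarrow> nat \<Rightarrow> 'a product_cochain \<Rightarrow> 'a product_cochain
       \<Rightarrow> bool" where
  "cong_mod_filtration A k F G \<longleftrightarrow> F - G \<in> filtration A 1 k"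

definition isotopic_mod ::
    "('k::field_char_0, 'a::ab_group_add) graded_algebra \<Rightarrow> nat \<Rightarrow> 'a product_cochain
       \<Rightarrow> 'a product_cochain \<Rightarrow> bool" where
  "isotopic_mod A k m m' \<longleftrightarrow>
     (\<exists>p \<in> filtration A 0 1. cong_mod_filtration A k (gauge_action A p m) m')"

definition kappa4 ::
    "('k::field, 'a::ab_group_add) graded_algebra \<Rightarrow> 'a cochain \<Rightarrow> 'a product_cochain
       \<Rightarrow> 'a product_cochain \<Rightarrow> 'a cochain" where
  "kappa4 A p2 m m' =
     m 4 - m' 4 + bracket A (2, -1) (3, -1) p2 (m 3)
     - scale_cochain A (1 / 2) (bracket A (2, -1) (3, -1) p2 (harrison_diff A (2, -1) p2))"

end

theory Submission
  imports Defs
begin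

text \<open>
  Write \<open>D = \<delta> p\<^sub>2\<close>, so that \<open>m'\<^sub>3 = m\<^sub>3 - D\<close>. In arities 4 and 5 the Maurer-Cartan equation says
  \<open>\<delta> m\<^sub>3 = 0\<close> and \<open>\<delta> m\<^sub>4 = - 1/2 [m\<^sub>3, m\<^sub>3]\<close>, and likewise for \<open>m'\<close>. Hence \<open>\<delta> D = 0\<close>, and as
  \<open>p\<^sub>2\<close> has degree 0, the Leibniz rule gives \<open>\<delta> [p\<^sub>2, X] = [D, X]\<close> for every cocycle \<open>X\<close> of arity 3.
  Expanding \<open>[m\<^sub>3 - D, m\<^sub>3 - D]\<close> with the symmetry of the bracket in degree 1,
    \<open>\<delta> (m\<^sub>4 - m'\<^sub>4) = 1/2 [m'\<^sub>3, m'\<^sub>3] - 1/2 [m\<^sub>3, m\<^sub>3] = - [D, m\<^sub>3] + 1/2 [D, D]\<close>,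
  which is cancelled by \<open>\<delta> ([p\<^sub>2, m\<^sub>3] - 1/2 [p\<^sub>2, D]) = [D, m\<^sub>3] - 1/2 [D, D]\<close>.

  Two facts about the Gerstenhaber bracket carry this computation. The first is the graded Jacobi
  identity, in the form of the Leibniz rule (\<open>harrison_diff_bracket\<close>). After suspension the bracket
  is the commutator of coderivations of the tensor coalgebra on \<open>sH\<close>. A coderivation \<open>D\<^sub>G\<close> is
  represented here by the operator \<open>F \<mapsto> F \<circ> D\<^sub>G\<close> on functions of words (\<open>coder_pullback\<close>). These
  operators satisfy a pre-Lie identity (\<open>coder_pullback_twice\<close>): the only terms of
  \<open>F \<circ> D\<^sub>G \<circ> D\<^sub>H\<close> that survive in the graded commutator are those where \<open>H\<close> is nested in \<open>G\<close> or
  \<open>G\<close> in \<open>H\<close>.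

  The second is that Harrison cochains are closed under the bracket
  (\<open>bracket_in_harrison_cochains\<close>), which is needed for the cochain to be a Harrison cochain at
  all. If \<open>G\<close> vanishes on shuffles, then \<open>D\<^sub>G\<close> is a derivation of the shuffle product
  (\<open>shuffle_eval_coder_pullback\<close>), because the coproduct is multiplicative for it
  (\<open>shuffle_eval_deconc\<close>); so \<open>F \<circ> D\<^sub>G\<close> vanishes on shuffles if \<open>F\<close> does.
\<close>

section \<open>Signs\<close>

lemma additive_sgn_pow: "additive (sgn_pow k)"
  by unfold_locales (simp add: sgn_pow_def)

lemmas sgn_pow_plus = additive.add [OF additive_sgn_pow]
lemmas sgn_pow_zero [simp] = additive.zero [OF additive_sgn_pow]

lemma sgn_pow_0 [simp]: "sgn_pow 0 x = x"
  by (simp add: sgn_pow_def)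

lemma sgn_pow_sgn_pow: "sgn_pow k (sgn_pow l x) = sgn_pow (k + l) x"
  by (auto simp: sgn_pow_def)

lemma sgn_pow_cong: "even (k - l) \<Longrightarrow> sgn_pow k x = sgn_pow l x"
  by (auto simp: sgn_pow_def)

lemma additive_sgn_pow_commute: "additive h \<Longrightarrow> h (sgn_pow k x) = sgn_pow k (h x)"
  by (simp add: sgn_pow_def additive.minus)

lemma sgn_pow_fun_apply: "sgn_pow k f x = sgn_pow k (f x)"
  by (simp add: sgn_pow_def)

section \<open>Deconcatenation\<close>

text \<open>\<open>deconc \<Phi> xs\<close> sums \<open>\<Phi> a b\<close> over all ways of writing \<open>xs = a @ b\<close>: the bilinear map \<open>\<Phi>\<close>
  evaluated on the deconcatenation coproduct of the tensor \<open>xs\<close>. The recursion on the list makes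
  coassociativity, exchange of two such sums and the compatibility with shuffles structural
  inductions, with no index arithmetic.\<close>
fun deconc :: "('b list \<Rightarrow> 'b list \<Rightarrow> 'c::ab_group_add) \<Rightarrow> 'b list \<Rightarrow> 'c" where
  "deconc \<Phi> [] = \<Phi> [] []"
| "deconc \<Phi> (x # xs) = \<Phi> [] (x # xs) + deconc (\<lambda>a b. \<Phi> (x # a) b) xs"

lemma deconc_cong:
  "(\<And>a b. a @ b = xs \<Longrightarrow> \<Phi> a b = \<Psi> a b) \<Longrightarrow> deconc \<Phi> xs = deconc \<Psi> xs"
proof (induction xs arbitrary: \<Phi> \<Psi>)
  case (Cons x xs)
  have "deconc (\<lambda>a b. \<Phi> (x # a) b) xs = deconc (\<lambda>a b. \<Psi> (x # a) b) xs"
    by (rule Cons.IH) (simp add: Cons.prems)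
  moreover have "\<Phi> [] (x # xs) = \<Psi> [] (x # xs)"
    by (rule Cons.prems) simp
  ultimately show ?case by simp
qed simp

lemma deconc_zero [simp]: "deconc (\<lambda>a b. 0) xs = 0"
  by (induction xs) auto

lemma deconc_add: "deconc (\<lambda>a b. \<Phi> a b + \<Psi> a b) xs = deconc \<Phi> xs + deconc \<Psi> xs"
  by (induction xs arbitrary: \<Phi> \<Psi>) (auto simp: algebra_simps)

lemma additive_deconc:
  "additive h \<Longrightarrow> h (deconc \<Phi> xs) = deconc (\<lambda>a b. h (\<Phi> a b)) xs"
  by (induction xs arbitrary: \<Phi>) (auto simp: additive.add)

lemma deconc_swap:
  "deconc (\<lambda>a b. deconc (\<lambda>c d. \<Phi> a b c d) ys) xs = deconc (\<lambda>c d. deconc (\<lambda>a b. \<Phi> a b c d) xs) ys"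
  by (induction xs arbitrary: \<Phi>) (auto simp: deconc_add)

lemma deconc_coassoc:
  "deconc (\<lambda>l c. deconc (\<lambda>a b. \<Phi> a b c) l) xs = deconc (\<lambda>a r. deconc (\<lambda>b c. \<Phi> a b c) r) xs"
  by (induction xs arbitrary: \<Phi>) (auto simp: deconc_add algebra_simps)

lemma deconc_map: "deconc \<Phi> (map f xs) = deconc (\<lambda>a b. \<Phi> (map f a) (map f b)) xs"
  by (induction xs arbitrary: \<Phi>) auto

text \<open>A cut of \<open>a @ y # c\<close> falls either to the left or to the right of the marked letter \<open>y\<close>. All
  statements below about a letter produced by an inserted map come from this splitting.\<close>
lemma deconc_append_Cons:
  "deconc \<Phi> (a @ y # c) =
     deconc (\<lambda>a1 a2. \<Phi> a1 (a2 @ y # c)) a + deconc (\<lambda>c1 c2. \<Phi> (a @ y # c1) c2) c"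
  by (induction a arbitrary: \<Phi>) (auto simp: algebra_simps)

lemma deconc_eq_sum_take_drop:
  "deconc \<Phi> xs = (\<Sum>i\<le>length xs. \<Phi> (take i xs) (drop i xs))"
proof (induction xs arbitrary: \<Phi>)
  case (Cons x xs)
  then show ?case
    by (simp add: sum.atMost_Suc_shift del: sum.atMost_Suc)
qed simp

lemma deconc_only_Nil_left:
  assumes "\<And>a b. a \<noteq> [] \<Longrightarrow> \<Phi> a b = 0"
  shows "deconc \<Phi> xs = \<Phi> [] xs"
proof (cases xs)
  case (Cons x ys)
  have "deconc (\<lambda>a b. \<Phi> (x # a) b) ys = deconc (\<lambda>a b. 0) ys"
    by (rule deconc_cong) (simp add: assms)
  then show ?thesis using Cons by simp
qed simp

section \<open>Coderivations\<close>

text \<open>Additivity in each argument is all that the Lie identities need from a multilinear map; scalars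
  enter only when results are shown to be cochains again.\<close>
definition multi_additive :: "('b::ab_group_add list \<Rightarrow> 'c::ab_group_add) \<Rightarrow> bool" where
  "multi_additive F \<longleftrightarrow> (\<forall>us vs. additive (\<lambda>x. F (us @ x # vs)))"

text \<open>The pullback \<open>F \<mapsto> F \<circ> D\<^sub>G\<close> along the coderivation \<open>D\<^sub>G\<close> of the tensor coalgebra with
  corestriction \<open>G\<close>; the map \<open>\<tau>\<close> acts on the letters that \<open>G\<close> has to pass and carries the Koszul
  sign. The word inserted into \<open>G\<close> may have any length, so no arities occur: a cochain of arity
  \<open>n\<close> is a function on all words that vanishes off length \<open>n\<close>.\<close>
definition coder_pullback :: "('b \<Rightarrow> 'b) \<Rightarrow> ('b list \<Rightarrow> 'b) \<Rightarrow> ('b list \<Rightarrow> 'c::ab_group_add) \<Rightarrow> 'b list \<Rightarrow> 'c" where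
  "coder_pullback \<tau> G F xs = deconc (\<lambda>a r. deconc (\<lambda>y z. F (map \<tau> a @ G y # z)) r) xs"

lemma deconc_sgn_pow: "deconc (\<lambda>a b. sgn_pow k (\<Phi> a b)) xs = sgn_pow k (deconc \<Phi> xs)"
  by (simp add: additive_deconc [OF additive_sgn_pow])

lemma multi_additiveD: "multi_additive F \<Longrightarrow> additive (\<lambda>x. F (us @ x # vs))"
  by (simp add: multi_additive_def)

lemma multi_additive_Cons: "multi_additive F \<Longrightarrow> multi_additive (\<lambda>w. F (x # w))"
  using multi_additiveD [of F "x # us" for us] by (simp add: multi_additive_def)

text \<open>The inserted word lies to the left of the marked letter \<open>y\<close>, contains it, or lies to its right;
  only in the last case does \<open>y\<close> meet the twist.\<close>
lemma coder_pullback_append_Cons: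
  "coder_pullback \<tau> G F (a @ y # c) =
     deconc (\<lambda>a1 r. deconc (\<lambda>g a3. F (map \<tau> a1 @ G g # a3 @ y # c)) r) a
   + deconc (\<lambda>a1 a2. deconc (\<lambda>c1 c2. F (map \<tau> a1 @ G (a2 @ y # c1) # c2)) c) a
   + deconc (\<lambda>c1 r. deconc (\<lambda>g c3. F (map \<tau> a @ \<tau> y # map \<tau> c1 @ G g # c3)) r) c"
  by (simp add: coder_pullback_def deconc_append_Cons deconc_add)

text \<open>Up to sign, the terms of \<open>F \<circ> D\<^sub>G \<circ> D\<^sub>H\<close> in which \<open>G\<close> and \<open>H\<close> are applied to disjoint words, \<open>G\<close> to the left
  of \<open>H\<close>.\<close>
definition double_insertion ::
  "('b \<Rightarrow> 'b) \<Rightarrow> ('b list \<Rightarrow> 'b) \<Rightarrow> ('b \<Rightarrow> 'b) \<Rightarrow> ('b list \<Rightarrow> 'b) \<Rightarrow> ('b list \<Rightarrow> 'c::ab_group_add) \<Rightarrow> 'b list \<Rightarrow> 'c" where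
  "double_insertion \<sigma> G \<tau> H F xs =
     deconc (\<lambda>a r. deconc (\<lambda>g r. deconc (\<lambda>b r. deconc (\<lambda>h c.
       F (map \<sigma> (map \<tau> a) @ \<tau> (G g) # map \<tau> b @ H h # c)) r) r) r) xs"

text \<open>The graded pre-Lie identity. In \<open>F \<circ> D\<^sub>G \<circ> D\<^sub>H\<close> the value of \<open>H\<close> is either fed into \<open>G\<close>, which
  gives the pullback along \<open>G \<circ> D\<^sub>H\<close>, or it is not; the two terms of the second kind are exchanged,
  up to the sign \<open>(-1)^k\<close>, when \<open>G\<close> and \<open>H\<close> trade places, and hence drop out of graded
  commutators. The sign arises because a \<open>G\<close> standing to the left of \<open>H\<close> receives letters that
  \<open>H\<close> has already twisted.\<close>
lemma coder_pullback_twice: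
  fixes F :: "'b::ab_group_add list \<Rightarrow> 'c::ab_group_add"
  assumes F: "multi_additive F" and G: "multi_additive G"
    and comm: "\<And>x. \<sigma> (\<tau> x) = \<tau> (\<sigma> x)"
    and G_sign: "\<And>ys. G (map \<tau> ys) = sgn_pow k (\<tau> (G ys))"
  shows "coder_pullback \<tau> H (coder_pullback \<sigma> G F) xs =
     coder_pullback (\<sigma> \<circ> \<tau>) (coder_pullback \<tau> H G) F xs
       + sgn_pow k (double_insertion \<sigma> G \<tau> H F xs) + double_insertion \<tau> H \<sigma> G F xs"
proof -
  let ?T1 = "\<lambda>a h c. deconc (\<lambda>a1 r. deconc (\<lambda>g a3.
       sgn_pow k (F (map \<sigma> (map \<tau> a1) @ \<tau> (G g) # map \<tau> a3 @ H h # c))) r) a"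
  let ?T2 = "\<lambda>a h c. deconc (\<lambda>a1 a2. deconc (\<lambda>c1 c2.
       F (map \<sigma> (map \<tau> a1) @ G (map \<tau> a2 @ H h # c1) # c2)) c) a"
  let ?T3 = "\<lambda>a h c. deconc (\<lambda>c1 r. deconc (\<lambda>g c3.
       F (map \<sigma> (map \<tau> a) @ \<sigma> (H h) # map \<sigma> c1 @ G g # c3)) r) c"
  have sign: "F (u @ G (map \<tau> g) # v) = sgn_pow k (F (u @ \<tau> (G g) # v))" for u g v
    using additive_sgn_pow_commute [OF multi_additiveD [OF F]] by (simp add: G_sign)
  have "coder_pullback \<tau> H (coder_pullback \<sigma> G F) xs
      = deconc (\<lambda>a r. deconc (\<lambda>h c. ?T1 a h c + ?T2 a h c + ?T3 a h c) r) xs"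
    unfolding coder_pullback_def [of \<tau>] coder_pullback_append_Cons deconc_map
    by (simp add: sign)
  also have "\<dots> = deconc (\<lambda>a r. deconc (\<lambda>h c. ?T1 a h c) r) xs
      + deconc (\<lambda>a r. deconc (\<lambda>h c. ?T2 a h c) r) xs
      + deconc (\<lambda>a r. deconc (\<lambda>h c. ?T3 a h c) r) xs"
    by (simp add: deconc_add)
  also have "deconc (\<lambda>a r. deconc (\<lambda>h c. ?T1 a h c) r) xs = sgn_pow k (double_insertion \<sigma> G \<tau> H F xs)"
  proof -
    have "deconc (\<lambda>h c. ?T1 a h c) r = deconc (\<lambda>a1 r'. deconc (\<lambda>g a3. deconc (\<lambda>h c.
       sgn_pow k (F (map \<sigma> (map \<tau> a1) @ \<tau> (G g) # map \<tau> a3 @ H h # c))) r) r') a" for a r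
      by (rule trans [OF deconc_swap], rule deconc_cong, rule deconc_swap)
    then show ?thesis
      by (simp add: deconc_coassoc double_insertion_def deconc_sgn_pow)
  qed
  also have "deconc (\<lambda>a r. deconc (\<lambda>h c. ?T2 a h c) r) xs = coder_pullback (\<sigma> \<circ> \<tau>) (coder_pullback \<tau> H G) F xs"
  proof -
    have "deconc (\<lambda>h c. ?T2 a h c) r = deconc (\<lambda>a1 a2. deconc (\<lambda>h c. deconc (\<lambda>c1 c2.
       F (map \<sigma> (map \<tau> a1) @ G (map \<tau> a2 @ H h # c1) # c2)) c) r) a" for a r
      by (rule deconc_swap)
    then show ?thesis
      by (simp add: coder_pullback_def deconc_coassoc additive_deconc [OF multi_additiveD [OF F]])
  qed
  also have "deconc (\<lambda>a r. deconc (\<lambda>h c. ?T3 a h c) r) xs = double_insertion \<tau> H \<sigma> G F xs"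
    by (simp add: double_insertion_def comm comp_def)
  finally show ?thesis by (simp only: ac_simps)
qed


text \<open>Additivity of \<open>F \<circ> D\<^sub>G\<close> in each of its two entries, as maps between groups of functions, so that
  differences and signs can be moved through by the general facts on additive maps.\<close>
lemma additive_coder_pullback: "additive (\<lambda>F. coder_pullback \<tau> G F)"
  by unfold_locales (simp add: fun_eq_iff coder_pullback_def deconc_add)

lemma additive_coder_pullback_inserted:
  assumes "multi_additive F"
  shows "additive (\<lambda>G. coder_pullback \<tau> G F)"
  using additive.add [OF multi_additiveD [OF assms]]
  by unfold_locales (simp add: fun_eq_iff coder_pullback_def deconc_add)

section \<open>Shuffle products\<close>

text \<open>Letters are paired with their degree in \<open>H\<close>, as for \<^const>\<open>shuffle_eval\<close>; the signs involve the
  degree in \<open>sH\<close>.\<close>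
abbreviation shifted_degree :: "('a \<times> int) list \<Rightarrow> int" where
  "shifted_degree u \<equiv> (\<Sum>z\<leftarrow>u. snd z - 1)"

lemma shuffle_eval_Nil_right [simp]: "shuffle_eval F u [] = F (map fst u)"
  by (cases u) auto

lemma additive_shuffle_eval:
  "additive h \<Longrightarrow> h (shuffle_eval F u v) = shuffle_eval (\<lambda>w. h (F w)) u v"
  by (induction F u v rule: shuffle_eval.induct)
    (auto simp: additive.add additive_sgn_pow_commute)

lemma shuffle_eval_add:
  "shuffle_eval (\<lambda>w. F w + G w) u v = shuffle_eval F u v + shuffle_eval G u v"
proof (induction F u v arbitrary: G rule: shuffle_eval.induct)
  case (3 F x u y v)
  show ?case
    by (simp add: "3.IH" sgn_pow_plus)
qed auto

lemma shuffle_eval_zero: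
  "(\<And>w. length w = length u + length v \<Longrightarrow> F w = 0) \<Longrightarrow> shuffle_eval F u v = 0"
proof (induction F u v rule: shuffle_eval.induct)
  case (3 F x u y v)
  then show ?case
    by (simp del: shuffle_eval.simps add: shuffle_eval.simps(3))
qed auto

lemma shuffle_eval_sgn_pow:
  "shuffle_eval (\<lambda>w. sgn_pow k (F w)) u v = sgn_pow k (shuffle_eval F u v)"
  by (simp add: additive_shuffle_eval [OF additive_sgn_pow])

text \<open>Deconcatenation is multiplicative for the shuffle product,
  \<open>\<Delta> (u * v) = \<Delta> u * \<Delta> v\<close>. The sign comes from moving the front part of \<open>v\<close> past the back part
  of \<open>u\<close>. In the inductive step, the first letter of a nonempty front part is the first letter of
  either word, which is the recursion defining the shuffle product.\<close>
lemma shuffle_eval_deconc: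
  fixes \<Phi> :: "'a list \<Rightarrow> 'a list \<Rightarrow> 'b::ab_group_add"
  shows "shuffle_eval (\<lambda>w. deconc \<Phi> w) u v =
     deconc (\<lambda>u1 u2. deconc (\<lambda>v1 v2. sgn_pow (shifted_degree v1 * shifted_degree u2)
       (shuffle_eval (\<lambda>w1. shuffle_eval (\<lambda>w2. \<Phi> w1 w2) u2 v2) u1 v1)) v) u"
proof (induction u arbitrary: \<Phi> v)
  case Nil
  then show ?case by (simp add: deconc_map)
next
  case (Cons x u)
  note IH_u = Cons.IH
  show ?case
  proof (induction v arbitrary: \<Phi>)
    case Nil
    then show ?case by (simp add: deconc_map)
  next
    case (Cons y v)
    note IH_v = Cons.IH
    let ?s = "snd y - 1" and ?d = "shifted_degree"
    let ?K = "\<lambda>u2 v2 w1. shuffle_eval (\<lambda>w2. \<Phi> w1 w2) u2 v2"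
    let ?X = "\<lambda>u1 u2 v1 v2. shuffle_eval (\<lambda>w1. ?K u2 v2 (fst x # w1)) u1 (y # v1)"
    let ?Y = "\<lambda>u1 u2 v1 v2. shuffle_eval (\<lambda>w1. ?K u2 v2 (fst y # w1)) (x # u1) v1"
    have sgn_y: "sgn_pow (?s * ?d (x # u)) (sgn_pow (?d v1 * ?d u2) z)
        = sgn_pow (?d (y # v1) * ?d u2) (sgn_pow (?s * ?d (x # u1)) z)"
      if "u1 @ u2 = u" for u1 u2 v1 and z :: 'b
      unfolding that [symmetric] sgn_pow_sgn_pow by (rule sgn_pow_cong) (simp add: algebra_simps)
    have "shuffle_eval (deconc \<Phi>) (x # u) (y # v) =
        shuffle_eval (\<lambda>w. \<Phi> [] (fst x # w)) u (y # v)
        + shuffle_eval (\<lambda>w. deconc (\<lambda>a b. \<Phi> (fst x # a) b) w) u (y # v)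
        + sgn_pow (?s * ?d (x # u))
          (shuffle_eval (\<lambda>w. \<Phi> [] (fst y # w)) (x # u) v
           + shuffle_eval (\<lambda>w. deconc (\<lambda>a b. \<Phi> (fst y # a) b) w) (x # u) v)"
      by (simp add: shuffle_eval_add)
    also have "\<dots> = ?K (x # u) (y # v) []
        + shuffle_eval (\<lambda>w. deconc (\<lambda>a b. \<Phi> (fst x # a) b) w) u (y # v)
        + sgn_pow (?s * ?d (x # u))
          (shuffle_eval (\<lambda>w. deconc (\<lambda>a b. \<Phi> (fst y # a) b) w) (x # u) v)"
      by (simp add: sgn_pow_plus)
    also have "shuffle_eval (\<lambda>w. deconc (\<lambda>a b. \<Phi> (fst x # a) b) w) u (y # v) =
        deconc (\<lambda>u1 u2. ?K u2 (y # v) (map fst (x # u1))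
          + deconc (\<lambda>v1 v2. sgn_pow (?d (y # v1) * ?d u2) (?X u1 u2 v1 v2)) v) u"
      unfolding IH_u by simp
    also have "shuffle_eval (\<lambda>w. deconc (\<lambda>a b. \<Phi> (fst y # a) b) w) (x # u) v =
        deconc (\<lambda>v1 v2. sgn_pow (?d v1 * ?d (x # u)) (?K (x # u) v2 (map fst (y # v1)))) v
        + deconc (\<lambda>u1 u2. deconc (\<lambda>v1 v2. sgn_pow (?d v1 * ?d u2) (?Y u1 u2 v1 v2)) v) u"
      unfolding IH_v by simp
    also have "sgn_pow (?s * ?d (x # u)) \<dots> =
        deconc (\<lambda>v1 v2. sgn_pow (?d (y # v1) * ?d (x # u)) (?K (x # u) v2 (map fst (y # v1)))) v
        + deconc (\<lambda>u1 u2. deconc (\<lambda>v1 v2. sgn_pow (?d (y # v1) * ?d u2)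
            (sgn_pow (?s * ?d (x # u1)) (?Y u1 u2 v1 v2))) v) u"
    proof -
      have "sgn_pow (?s * ?d (x # u)) (deconc (\<lambda>v1 v2. sgn_pow (?d v1 * ?d u2) (?Y u1 u2 v1 v2)) v)
          = deconc (\<lambda>v1 v2. sgn_pow (?d (y # v1) * ?d u2)
            (sgn_pow (?s * ?d (x # u1)) (?Y u1 u2 v1 v2))) v" if "u1 @ u2 = u" for u1 u2
        unfolding deconc_sgn_pow [symmetric] by (rule deconc_cong, rule sgn_y, rule that)
      then have "sgn_pow (?s * ?d (x # u))
            (deconc (\<lambda>u1 u2. deconc (\<lambda>v1 v2. sgn_pow (?d v1 * ?d u2) (?Y u1 u2 v1 v2)) v) u) =
          deconc (\<lambda>u1 u2. deconc (\<lambda>v1 v2. sgn_pow (?d (y # v1) * ?d u2)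
            (sgn_pow (?s * ?d (x # u1)) (?Y u1 u2 v1 v2))) v) u"
        unfolding deconc_sgn_pow [symmetric, where \<Phi> = "\<lambda>u1 u2. deconc (\<Psi> u1 u2) v" for \<Psi>]
        by (intro deconc_cong)
      moreover have "sgn_pow (?s * ?d (x # u))
            (deconc (\<lambda>v1 v2. sgn_pow (?d v1 * ?d (x # u)) (?K (x # u) v2 (map fst (y # v1)))) v) =
          deconc (\<lambda>v1 v2. sgn_pow (?d (y # v1) * ?d (x # u)) (?K (x # u) v2 (map fst (y # v1)))) v"
        unfolding deconc_sgn_pow [symmetric] sgn_pow_sgn_pow
        by (intro deconc_cong sgn_pow_cong) (simp add: algebra_simps)
      ultimately show ?thesis by (simp only: sgn_pow_plus)
    qed
    finally show ?case
      by (simp add: deconc_add sgn_pow_plus algebra_simps)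
  qed
qed


lemma shuffle_eval_commute:
  "shuffle_eval F u v = sgn_pow (shifted_degree u * shifted_degree v) (shuffle_eval F v u)"
proof (induction F u v rule: shuffle_eval.induct)
  case (3 F x u y v)
  show ?case
    unfolding shuffle_eval.simps(3) "3.IH" sgn_pow_plus sgn_pow_sgn_pow
    by (subst add.commute, intro arg_cong2 [where f = "(+)"] sgn_pow_cong) (simp_all add: algebra_simps)
qed auto

text \<open>A shuffle of \<open>a @ c # b\<close> with \<open>v\<close> is cut at the letter \<open>c\<close>: the part of \<open>v\<close> that precedes \<open>c\<close> is
  shuffled with \<open>a\<close>, the rest with \<open>b\<close>.\<close>
lemma shuffle_eval_insert_left:
  fixes F :: "'a list \<Rightarrow> 'b::ab_group_add"
  shows "shuffle_eval F (a @ c # b) v =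
     deconc (\<lambda>v1 v2. sgn_pow (shifted_degree v1 * shifted_degree (c # b))
       (shuffle_eval (\<lambda>w1. shuffle_eval (\<lambda>w2. F (w1 @ fst c # w2)) b v2) a v1)) v"
proof (induction a arbitrary: F v)
  case Nil
  show ?case
  proof (induction v arbitrary: F)
    case (Cons y v)
    let ?d = shifted_degree
    have "sgn_pow ((snd y - 1) * ?d (c # b)) (shuffle_eval (\<lambda>w. F (fst y # w)) (c # b) v) =
      deconc (\<lambda>v1 v2. sgn_pow (?d (y # v1) * ?d (c # b))
        (shuffle_eval (\<lambda>w2. F (map fst (y # v1) @ fst c # w2)) b v2)) v"
      using Cons [of "\<lambda>w. F (fst y # w)"]
      by (simp add: deconc_sgn_pow [symmetric] sgn_pow_sgn_pow)
        (auto intro!: deconc_cong sgn_pow_cong simp: algebra_simps)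
    then show ?case by simp
  qed simp
next
  case (Cons x a)
  note IH_a = Cons.IH
  show ?case
  proof (induction v arbitrary: F)
    case Nil
    then show ?case by simp
  next
    case (Cons y v)
    note IH_v = Cons.IH
    let ?d = shifted_degree
    let ?K = "\<lambda>v2 w1. shuffle_eval (\<lambda>w2. F (w1 @ fst c # w2)) b v2"
    have "sgn_pow ((snd y - 1) * ?d (x # a @ c # b)) (sgn_pow (?d v1 * ?d (c # b)) z)
        = sgn_pow (?d (y # v1) * ?d (c # b)) (sgn_pow ((snd y - 1) * ?d (x # a)) z)"
      for v1 and z :: 'b
      unfolding sgn_pow_sgn_pow by (rule sgn_pow_cong) (simp add: algebra_simps)
    then have "sgn_pow ((snd y - 1) * ?d (x # a @ c # b))
        (shuffle_eval (\<lambda>w. F (fst y # w)) (x # a @ c # b) v) =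
      deconc (\<lambda>v1 v2. sgn_pow (?d (y # v1) * ?d (c # b)) (sgn_pow ((snd y - 1) * ?d (x # a))
        (shuffle_eval (\<lambda>w1. ?K v2 (fst y # w1)) (x # a) v1))) v"
      using IH_v [of "\<lambda>w. F (fst y # w)"]
      by (simp only: append_Cons deconc_sgn_pow [symmetric] list.map sum_list.Cons)
    moreover have "shuffle_eval (\<lambda>w. F (fst x # w)) (a @ c # b) (y # v) =
       ?K (y # v) (map fst (x # a))
       + deconc (\<lambda>v1 v2. sgn_pow (?d (y # v1) * ?d (c # b))
          (shuffle_eval (\<lambda>w1. ?K v2 (fst x # w1)) a (y # v1))) v"
      unfolding IH_a by simp
    ultimately show ?case
      by (simp add: deconc_add sgn_pow_plus)
  qed
qed

lemma shuffle_eval_insert_right: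
  fixes F :: "'a list \<Rightarrow> 'b::ab_group_add"
  shows "shuffle_eval F u (a @ c # b) =
     deconc (\<lambda>u1 u2. sgn_pow ((shifted_degree a + snd c - 1) * shifted_degree u2)
       (shuffle_eval (\<lambda>w1. shuffle_eval (\<lambda>w2. F (w1 @ fst c # w2)) u2 b) u1 a)) u"
proof -
  let ?d = shifted_degree
  let ?K = "\<lambda>u2 w1. shuffle_eval (\<lambda>w2. F (w1 @ fst c # w2)) u2 b"
  have "sgn_pow (?d u * ?d (a @ c # b)) (sgn_pow (?d u1 * ?d (c # b))
      (shuffle_eval (\<lambda>w1. shuffle_eval (\<lambda>w2. F (w1 @ fst c # w2)) b u2) a u1)) =
    sgn_pow ((?d a + snd c - 1) * ?d u2) (shuffle_eval (?K u2) u1 a)"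
    if "u1 @ u2 = u" for u1 u2
    unfolding shuffle_eval_commute [where u = b] shuffle_eval_commute [where u = a]
      shuffle_eval_sgn_pow sgn_pow_sgn_pow that [symmetric]
    by (rule sgn_pow_cong) (simp add: algebra_simps)
  then show ?thesis
    unfolding shuffle_eval_commute [of F u] shuffle_eval_insert_left
      deconc_sgn_pow [symmetric, where xs = u]
    by (intro deconc_cong)
qed

lemma shuffle_eval_deconc_const:
  "shuffle_eval (\<lambda>w. deconc (\<lambda>a b. \<Phi> w a b) xs) u v = deconc (\<lambda>a b. shuffle_eval (\<lambda>w. \<Phi> w a b) u v) xs"
  by (induction xs arbitrary: \<Phi>) (auto simp: shuffle_eval_add)

text \<open>The situation of a summand that sees two words through a map killing shuffles of nonempty words:
  only the two axes of the double sum survive.\<close>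
lemma deconc_deconc_axes:
  assumes "\<And>a b c d. a \<noteq> [] \<Longrightarrow> c \<noteq> [] \<Longrightarrow> \<Phi> a b c d = 0" and "\<Phi> [] xs [] ys = 0"
  shows "deconc (\<lambda>a b. deconc (\<lambda>c d. \<Phi> a b c d) ys) xs =
     deconc (\<lambda>a b. \<Phi> a b [] ys) xs + deconc (\<lambda>c d. \<Phi> [] xs c d) ys"
proof (cases xs)
  case Nil
  then show ?thesis using assms(2) by simp
next
  case (Cons x zs)
  have "deconc (\<lambda>c d. \<Phi> (x # a) b c d) ys = \<Phi> (x # a) b [] ys" for a b
    by (rule deconc_only_Nil_left) (simp add: assms(1))
  then show ?thesis using Cons assms(2) by (simp add: algebra_simps)
qed

definition homogeneous_letters :: "(int \<Rightarrow> 'a set) \<Rightarrow> ('a \<times> int) list \<Rightarrow> bool" where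
  "homogeneous_letters gr u \<longleftrightarrow> (\<forall>(x, d) \<in> set u. x \<in> gr d)"

lemma homogeneous_letters_simps [simp]:
  "homogeneous_letters gr []"
  "homogeneous_letters gr (z # u) \<longleftrightarrow> fst z \<in> gr (snd z) \<and> homogeneous_letters gr u"
  "homogeneous_letters gr (u @ v) \<longleftrightarrow> homogeneous_letters gr u \<and> homogeneous_letters gr v"
  by (auto simp: homogeneous_letters_def case_prod_beta)

lemma multi_additive_map_twist:
  assumes "multi_additive F" and "homogeneous_letters gr u"
    and "\<And>x d. x \<in> gr d \<Longrightarrow> \<tau> x = sgn_pow (g * (d - 1)) x"
  shows "F (map \<tau> (map fst u)) = sgn_pow (g * shifted_degree u) (F (map fst u))"
  using assms(1,2)
proof (induction u arbitrary: F)
  case (Cons z u)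
  have "F (\<tau> (fst z) # map fst u) = sgn_pow (g * (snd z - 1)) (F (fst z # map fst u))"
    using Cons.prems additive_sgn_pow_commute [OF multi_additiveD [of F "[]"]]
    by (simp add: assms(3) [of "fst z" "snd z"])
  then show ?case
    using Cons.IH [OF multi_additive_Cons [OF Cons.prems(1)]] Cons.prems
    by (simp add: sgn_pow_sgn_pow algebra_simps)
qed simp

lemma shuffle_eval_map_twist:
  assumes "multi_additive F" and "homogeneous_letters gr u" and "homogeneous_letters gr v"
    and twist: "\<And>x d. x \<in> gr d \<Longrightarrow> \<tau> x = sgn_pow (g * (d - 1)) x"
  shows "shuffle_eval (\<lambda>w. F (map \<tau> w)) u v =
    sgn_pow (g * (shifted_degree u + shifted_degree v)) (shuffle_eval F u v)"
  using assms(1-3)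
proof (induction F u v rule: shuffle_eval.induct)
  case (1 F v)
  then show ?case using multi_additive_map_twist [where F = F and u = v, OF _ _ twist] by simp
next
  case (2 F x u)
  then show ?case using multi_additive_map_twist [where F = F and u = "x # u", OF _ _ twist] by simp
next
  case (3 F x u y v)
  have head: "F (\<tau> (fst z) # w) = sgn_pow (g * (snd z - 1)) (F (fst z # w))"
    if "fst z \<in> gr (snd z)" for z w
    using additive_sgn_pow_commute [OF multi_additiveD [of F "[]"]] "3.prems"(1) that
    by (simp add: twist [of "fst z" "snd z"])
  have "shuffle_eval (\<lambda>w. F (fst x # map \<tau> w)) u (y # v) =
      sgn_pow (g * (shifted_degree u + shifted_degree (y # v))) (shuffle_eval (\<lambda>w. F (fst x # w)) u (y # v))"
    by (rule "3.IH"(1)) (use "3.prems" in \<open>simp_all add: multi_additive_Cons\<close>)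
  moreover have "shuffle_eval (\<lambda>w. F (fst y # map \<tau> w)) (x # u) v =
      sgn_pow (g * (shifted_degree (x # u) + shifted_degree v)) (shuffle_eval (\<lambda>w. F (fst y # w)) (x # u) v)"
    by (rule "3.IH"(2)) (use "3.prems" in \<open>simp_all add: multi_additive_Cons\<close>)
  ultimately show ?case
    using "3.prems"
    by (simp add: head shuffle_eval_sgn_pow sgn_pow_sgn_pow sgn_pow_plus algebra_simps)
qed


lemma multi_additive_shuffle_eval:
  assumes "\<And>w. multi_additive (\<lambda>x. F x w)"
  shows "multi_additive (\<lambda>x. shuffle_eval (F x) u v)"
  unfolding multi_additive_def
proof (intro allI additive.intro)
  fix us vs x y
  have "F (us @ (x + y) # vs) = (\<lambda>w. F (us @ x # vs) w + F (us @ y # vs) w)"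
    using additive.add [OF multi_additiveD [OF assms]] by auto
  then show "shuffle_eval (F (us @ (x + y) # vs)) u v =
      shuffle_eval (F (us @ x # vs)) u v + shuffle_eval (F (us @ y # vs)) u v"
    by (simp only: shuffle_eval_add)
qed

lemma multi_additive_append: "multi_additive F \<Longrightarrow> multi_additive (\<lambda>x. F (x @ w))"
  by (simp add: multi_additive_def)

text \<open>If \<open>G\<close> vanishes on shuffles then \<open>D\<^sub>G\<close> is a derivation of the shuffle product: \<open>D\<^sub>G (u * v)\<close> is
  \<open>D\<^sub>G u * v\<close> plus, up to sign, \<open>u * D\<^sub>G v\<close>. Cutting \<open>u * v\<close> into three parts by multiplicativity of
  the coproduct, the middle part is a shuffle of a piece of \<open>u\<close> with a piece of \<open>v\<close>; \<open>G\<close> kills it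
  unless one of the pieces is empty, and the two remaining families are the two sides of the Leibniz
  rule, each reassembled around the letter that \<open>G\<close> produces. That letter carries its degree
  \<open>g + 1\<close> above the degree in \<open>sH\<close> of the word that it replaces.\<close>
theorem shuffle_eval_coder_pullback:
  fixes F :: "'a::ab_group_add list \<Rightarrow> 'b::ab_group_add"
  assumes F: "multi_additive F" and G_Nil: "G [] = 0"
    and G: "\<And>u v. u \<noteq> [] \<Longrightarrow> v \<noteq> [] \<Longrightarrow> homogeneous_letters gr u \<Longrightarrow> homogeneous_letters gr v
        \<Longrightarrow> shuffle_eval G u v = 0"
    and twist: "\<And>x d. x \<in> gr d \<Longrightarrow> \<tau> x = sgn_pow (g * (d - 1)) x"
    and hom: "homogeneous_letters gr u" "homogeneous_letters gr v"
  shows "shuffle_eval (coder_pullback \<tau> G F) u v =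
    deconc (\<lambda>u1 r. deconc (\<lambda>u2 u3. sgn_pow (g * shifted_degree u1)
      (shuffle_eval F (u1 @ (G (map fst u2), shifted_degree u2 + g + 1) # u3) v)) r) u
    + sgn_pow (g * shifted_degree u)
      (deconc (\<lambda>v1 r. deconc (\<lambda>v2 v3. sgn_pow (g * shifted_degree v1)
        (shuffle_eval F u (v1 @ (G (map fst v2), shifted_degree v2 + g + 1) # v3))) r) v)"
    (is "_ = ?L + ?R")
proof -
  let ?d = shifted_degree and ?S = shuffle_eval
  let ?h = "\<lambda>w1 u3 v3 y. ?S (\<lambda>z. F (w1 @ y # z)) u3 v3"
  have add_h: "additive (?h w1 u3 v3)" for w1 u3 v3
    using additive.add [OF multi_additiveD [OF F]] by unfold_locales (simp add: shuffle_eval_add)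
  have inner: "?S (\<lambda>r. deconc (\<lambda>y z. F (w @ G y # z)) r) ur vr =
      deconc (\<lambda>u2 u3. ?h w u3 vr (G (map fst u2))) ur
      + deconc (\<lambda>v2 v3. sgn_pow (?d v2 * ?d ur) (?h w ur v3 (G (map fst v2)))) vr"
    if hom': "homogeneous_letters gr ur" "homogeneous_letters gr vr" for w ur vr
  proof -
    let ?N = "\<lambda>u2 u3 v2 v3. sgn_pow (?d v2 * ?d u3) (?h w u3 v3 (?S G u2 v2))"
    have "?S (\<lambda>r. deconc (\<lambda>y z. F (w @ G y # z)) r) ur vr
        = deconc (\<lambda>u2 u3. deconc (\<lambda>v2 v3. ?N u2 u3 v2 v3) vr) ur"
      unfolding shuffle_eval_deconc
      by (simp only: additive_shuffle_eval [OF add_h])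
    also have "\<dots> = deconc (\<lambda>u2 u3. deconc (\<lambda>v2 v3.
        if u2 \<noteq> [] \<and> v2 \<noteq> [] then 0 else ?N u2 u3 v2 v3) vr) ur"
    proof (intro deconc_cong)
      fix u2 u3 v2 v3 assume "u2 @ u3 = ur" "v2 @ v3 = vr"
      then have "homogeneous_letters gr u2" "homogeneous_letters gr v2"
        using hom' by auto
      then show "?N u2 u3 v2 v3 = (if u2 \<noteq> [] \<and> v2 \<noteq> [] then 0 else ?N u2 u3 v2 v3)"
        by (simp add: G additive.zero [OF add_h])
    qed
    also have "\<dots> = deconc (\<lambda>u2 u3. ?N u2 u3 [] vr) ur + deconc (\<lambda>v2 v3. ?N [] ur v2 v3) vr"
      by (subst deconc_deconc_axes) (simp_all add: G_Nil additive.zero [OF add_h])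
    finally show ?thesis by simp
  qed
  have untwist: "?S (\<lambda>w1. ?h (map \<tau> w1) u3 v3 y) u1 v1
      = sgn_pow (g * (?d u1 + ?d v1)) (?S (\<lambda>w1. ?h w1 u3 v3 y) u1 v1)"
    if "homogeneous_letters gr u1" "homogeneous_letters gr v1" for u1 v1 u3 v3 y
    by (rule shuffle_eval_map_twist [OF _ that twist])
      (rule multi_additive_shuffle_eval, rule multi_additive_append [OF F])
  let ?B = "\<lambda>u1 v1 u3 v3 y. ?S (\<lambda>w1. ?h w1 u3 v3 y) u1 v1"
  let ?LL = "\<lambda>u1 ur v1 vr. deconc (\<lambda>u2 u3. sgn_pow (?d v1 * ?d ur + g * (?d u1 + ?d v1))
      (?B u1 v1 u3 vr (G (map fst u2)))) ur"
  let ?RR = "\<lambda>u1 ur v1 vr. deconc (\<lambda>v2 v3. sgn_pow (?d v1 * ?d ur + g * (?d u1 + ?d v1) + ?d v2 * ?d ur)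
      (?B u1 v1 ur v3 (G (map fst v2)))) vr"
  have "?S (coder_pullback \<tau> G F) u v =
      deconc (\<lambda>u1 ur. deconc (\<lambda>v1 vr. sgn_pow (?d v1 * ?d ur)
        (?S (\<lambda>w1. ?S (\<lambda>r. deconc (\<lambda>y z. F (map \<tau> w1 @ G y # z)) r) ur vr) u1 v1)) v) u"
    unfolding coder_pullback_def [abs_def] shuffle_eval_deconc [of _ u v] ..
  also have "\<dots> = deconc (\<lambda>u1 ur. deconc (\<lambda>v1 vr. ?LL u1 ur v1 vr + ?RR u1 ur v1 vr) v) u"
  proof (intro deconc_cong)
    fix u1 ur v1 vr assume "u1 @ ur = u" "v1 @ vr = v"
    then have "homogeneous_letters gr u1" "homogeneous_letters gr v1"
      "homogeneous_letters gr ur" "homogeneous_letters gr vr"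
      using hom by auto
    then show "sgn_pow (?d v1 * ?d ur)
        (?S (\<lambda>w1. ?S (\<lambda>r. deconc (\<lambda>y z. F (map \<tau> w1 @ G y # z)) r) ur vr) u1 v1)
        = ?LL u1 ur v1 vr + ?RR u1 ur v1 vr"
      by (simp add: inner shuffle_eval_add shuffle_eval_deconc_const shuffle_eval_sgn_pow untwist
        deconc_sgn_pow [symmetric] sgn_pow_plus sgn_pow_sgn_pow ac_simps)
  qed
  also have "\<dots> = deconc (\<lambda>u1 ur. deconc (\<lambda>v1 vr. ?LL u1 ur v1 vr) v) u
      + deconc (\<lambda>u1 ur. deconc (\<lambda>v1 vr. ?RR u1 ur v1 vr) v) u"
    by (simp add: deconc_add)
  also have "deconc (\<lambda>u1 ur. deconc (\<lambda>v1 vr. ?LL u1 ur v1 vr) v) u = ?L"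
  proof (rule deconc_cong)
    fix u1 ur assume "u1 @ ur = u"
    have "deconc (\<lambda>v1 vr. ?LL u1 ur v1 vr) v = deconc (\<lambda>u2 u3. deconc (\<lambda>v1 vr.
       sgn_pow (?d v1 * ?d ur + g * (?d u1 + ?d v1)) (?B u1 v1 u3 vr (G (map fst u2)))) v) ur"
      by (rule deconc_swap)
    also have "\<dots> = deconc (\<lambda>u2 u3. sgn_pow (g * ?d u1)
      (?S F (u1 @ (G (map fst u2), ?d u2 + g + 1) # u3) v)) ur"
      unfolding shuffle_eval_insert_left deconc_sgn_pow [symmetric, where xs = v] sgn_pow_sgn_pow
      by (intro deconc_cong) (auto intro!: sgn_pow_cong simp: algebra_simps)
    finally show "deconc (\<lambda>v1 vr. ?LL u1 ur v1 vr) v = \<dots>" .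
  qed
  also have "deconc (\<lambda>u1 ur. deconc (\<lambda>v1 vr. ?RR u1 ur v1 vr) v) u = ?R"
  proof -
    have "deconc (\<lambda>u1 ur. deconc (\<lambda>v1 vr. ?RR u1 ur v1 vr) v) u =
      deconc (\<lambda>v1 vr. deconc (\<lambda>u1 ur. ?RR u1 ur v1 vr) u) v"
      by (rule deconc_swap)
    also have "\<dots> = deconc (\<lambda>v1 vr. deconc (\<lambda>v2 v3. deconc (\<lambda>u1 ur.
      sgn_pow (?d v1 * ?d ur + g * (?d u1 + ?d v1) + ?d v2 * ?d ur)
        (?B u1 v1 ur v3 (G (map fst v2)))) u) vr) v"
      by (intro deconc_cong deconc_swap)
    also have "\<dots> = ?R"
      unfolding shuffle_eval_insert_right deconc_sgn_pow [symmetric] sgn_pow_sgn_pow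
      by (intro deconc_cong) (auto intro!: sgn_pow_cong simp: algebra_simps)
    finally show ?thesis .
  qed
  finally show ?thesis .
qed

section \<open>Homogeneous components and Koszul twists\<close>

text \<open>The list of letters to which \<^const>\<open>suspend\<close> applies its argument: a letter is twisted once for
  every letter to its right. Written recursively, it commutes with the splittings used here.\<close>
primrec suspension_twist :: "('k, 'a::ab_group_add) graded_algebra \<Rightarrow> 'a list \<Rightarrow> 'a list" where
  "suspension_twist A [] = []"
| "suspension_twist A (x # xs) = sign_twist A (\<lambda>d. int (length xs) * d) x # suspension_twist A xs"

abbreviation koszul_twist :: "('k, 'a::ab_group_add) graded_algebra \<Rightarrow> int \<Rightarrow> 'a \<Rightarrow> 'a" where
  "koszul_twist A e \<equiv> sign_twist A (\<lambda>d. e * (d - 1))"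

lemma length_suspension_twist [simp]: "length (suspension_twist A xs) = length xs"
  by (induction xs) auto

lemma suspend_eq: "suspend A f xs = f (suspension_twist A xs)"
proof -
  have "map (\<lambda>k. sign_twist A (\<lambda>d. (int (length xs) - 1 - int k) * d) (xs ! k)) [0..<length xs]
      = suspension_twist A xs"
  proof (induction xs)
    case (Cons x xs)
    then show ?case
      by (simp add: upt_conv_Cons map_Suc_upt [symmetric] comp_def diff_diff_eq del: upt_Suc)
  qed simp
  then show ?thesis by (simp add: suspend_def)
qed

lemma suspension_twist_append_Cons:
  "\<exists>us'. length us' = length us \<and> (\<forall>x. suspension_twist A (us @ x # vs) =
     us' @ sign_twist A (\<lambda>d. int (length vs) * d) x # suspension_twist A vs)"
proof (induction us)
  case (Cons u us)
  then obtain us' where "length us' = length us" "\<forall>x. suspension_twist A (us @ x # vs) =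
     us' @ sign_twist A (\<lambda>d. int (length vs) * d) x # suspension_twist A vs" by blast
  then show ?case
    by (intro exI [of _ "sign_twist A (\<lambda>d. int (length us + Suc (length vs)) * d) u # us'"]) simp
qed simp

context fd_graded_comm_algebra
begin

abbreviation linear_map :: "('a \<Rightarrow> 'a) \<Rightarrow> bool" where
  "linear_map \<equiv> Vector_Spaces.linear (scl A) (scl A)"

lemma linear_map_iff:
  "linear_map h \<longleftrightarrow> additive h \<and> (\<forall>c x. h (scl A c x) = scl A c (h x))"
  by (simp add: Vector_Spaces.linear_iff vector_space_axioms additive_def)

lemma additive_scl: "additive (scl A c)"
  by unfold_locales (rule scale_right_distrib)

lemma homogeneous_decomp_component: "homogeneous_decomp A x (\<lambda>i. component A i x)"
  unfolding component_def using theI' [OF grd_direct_sum [of x]] by simp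

lemma component_eqI: "homogeneous_decomp A x c \<Longrightarrow> component A i x = c i"
  using grd_direct_sum [of x] homogeneous_decomp_component [of x] by (metis (full_types))

lemma homogeneous_decompI:
  assumes "finite I" "\<And>i. i \<notin> I \<Longrightarrow> c i = 0" "\<And>i. c i \<in> grd A i" "x = sum c I"
  shows "homogeneous_decomp A x c"
  unfolding homogeneous_decomp_def
proof (intro conjI allI)
  have sub: "{i. c i \<noteq> 0} \<subseteq> I" using assms(2) by auto
  then show "finite {i. c i \<noteq> 0}" using assms(1) finite_subset by blast
  show "x = (\<Sum>i | c i \<noteq> 0. c i)"
    unfolding assms(4) by (rule sum.mono_neutral_right) (use assms(1) sub in auto)
qed (rule assms(3))

lemma finite_component: "finite {i. component A i x \<noteq> 0}"
  using homogeneous_decomp_component [of x] by (simp add: homogeneous_decomp_def)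

lemma component_in_grd: "component A i x \<in> grd A i"
  using homogeneous_decomp_component [of x] by (simp add: homogeneous_decomp_def)

lemma sum_component:
  assumes "finite I" "{i. component A i x \<noteq> 0} \<subseteq> I"
  shows "(\<Sum>i\<in>I. component A i x) = x"
proof -
  have "x = (\<Sum>i | component A i x \<noteq> 0. component A i x)"
    using homogeneous_decomp_component [of x] by (simp add: homogeneous_decomp_def)
  also have "\<dots> = (\<Sum>i\<in>I. component A i x)"
    by (rule sum.mono_neutral_left) (use assms in auto)
  finally show ?thesis by simp
qed

lemma linear_component: "linear_map (component A i)"
  unfolding linear_map_iff
proof (intro conjI allI additive.intro)
  fix x y
  let ?I = "{i. component A i x \<noteq> 0} \<union> {i. component A i y \<noteq> 0}"
  show "component A i (x + y) = component A i x + component A i y"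
  proof (rule component_eqI, rule homogeneous_decompI [of ?I])
    show "x + y = (\<Sum>i\<in>?I. component A i x + component A i y)"
      unfolding sum.distrib by (subst (1 2) sum_component) (simp_all add: finite_component)
  qed (auto simp: finite_component component_in_grd subspace_add [OF grd_subspace])
next
  fix c x
  let ?I = "{i. component A i x \<noteq> 0}"
  show "component A i (scl A c x) = scl A c (component A i x)"
  proof (rule component_eqI, rule homogeneous_decompI [of ?I])
    show "scl A c x = (\<Sum>i\<in>?I. scl A c (component A i x))"
      unfolding scale_sum_right [symmetric] by (subst sum_component) (simp_all add: finite_component)
  qed (auto simp: finite_component component_in_grd subspace_scale [OF grd_subspace])
qed

lemma component_of_homogeneous:
  "x \<in> grd A d \<Longrightarrow> component A i x = (if i = d then x else 0)"
  by (rule component_eqI, rule homogeneous_decompI [of "{d}"])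
    (auto simp: subspace_0 [OF grd_subspace])

lemma sign_twist_eq_sum:
  assumes "finite I" "{i. component A i x \<noteq> 0} \<subseteq> I"
  shows "sign_twist A s x = (\<Sum>i\<in>I. sgn_pow (s i) (component A i x))"
  unfolding sign_twist_def
  by (rule Sum_any.expand_superset) (use assms in \<open>auto simp: sgn_pow_def split: if_splits\<close>)

lemma sign_twist_homogeneous: "x \<in> grd A d \<Longrightarrow> sign_twist A s x = sgn_pow (s d) x"
  by (subst sign_twist_eq_sum [of "{d}"]) (auto simp: component_of_homogeneous)

lemma linear_sign_twist: "linear_map (sign_twist A s)"
  unfolding linear_map_iff
proof (intro conjI allI additive.intro)
  note lin = linear_component [unfolded linear_map_iff]
  fix x y
  let ?I = "{i. component A i x \<noteq> 0} \<union> {i. component A i y \<noteq> 0}"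
  have "{i. component A i (x + y) \<noteq> 0} \<subseteq> ?I"
    using additive.add [OF conjunct1 [OF lin]] by auto
  then show "sign_twist A s (x + y) = sign_twist A s x + sign_twist A s y"
    by (subst (1 2 3) sign_twist_eq_sum [of ?I])
      (auto simp: finite_component additive.add [OF conjunct1 [OF lin]] sgn_pow_plus sum.distrib)
next
  note lin = linear_component [unfolded linear_map_iff]
  fix c x
  let ?I = "{i. component A i x \<noteq> 0}"
  have "{i. component A i (scl A c x) \<noteq> 0} \<subseteq> ?I"
    using lin by auto
  then show "sign_twist A s (scl A c x) = scl A c (sign_twist A s x)"
    by (subst (1 2) sign_twist_eq_sum [of ?I])
      (auto simp: finite_component lin additive_sgn_pow_commute [OF additive_scl] scale_sum_right)
qed

lemmas additive_sign_twist = conjunct1 [OF linear_sign_twist [unfolded linear_map_iff]]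

lemma sgn_pow_in_grd: "x \<in> grd A d \<Longrightarrow> sgn_pow k x \<in> grd A d"
  by (simp add: sgn_pow_def subspace_neg [OF grd_subspace])

lemma sign_twist_in_grd: "x \<in> grd A d \<Longrightarrow> sign_twist A s x \<in> grd A d"
  by (simp add: sign_twist_homogeneous sgn_pow_in_grd)

text \<open>Every letter is the sum of its homogeneous components, so words of homogeneous letters decide
  equality. The induction replaces the letters from the left by homogeneous ones.\<close>
lemma multi_additive_eqI:
  assumes F: "multi_additive F" and G: "multi_additive G"
    and eq: "\<And>u. homogeneous_letters (grd A) u \<Longrightarrow> F (map fst u) = G (map fst u)"
  shows "F xs = G xs"
proof -
  have "F (map fst u @ xs) = G (map fst u @ xs)" if "homogeneous_letters (grd A) u" for u
    using that
  proof (induction xs arbitrary: u)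
    case Nil
    then show ?case using eq by simp
  next
    case (Cons x xs)
    let ?I = "{i. component A i x \<noteq> 0}"
    have x: "x = (\<Sum>i\<in>?I. component A i x)"
      by (rule sum_component [symmetric]) (auto simp: finite_component)
    have "F (map fst u @ component A i x # xs) = G (map fst u @ component A i x # xs)" for i
      using Cons.IH [of "u @ [(component A i x, i)]"] Cons.prems
      by (simp add: component_in_grd)
    then show ?case
      by (subst (1 2) x) (simp add: additive.sum [OF multi_additiveD [OF F]]
        additive.sum [OF multi_additiveD [OF G]])
  qed
  from this [of "[]"] show ?thesis by simp
qed

lemma sign_twist_sign_twist:
  "sign_twist A s (sign_twist A t x) = sign_twist A (\<lambda>d. s d + t d) x"
proof -
  let ?I = "{i. component A i x \<noteq> 0}"
  have x: "x = (\<Sum>i\<in>?I. component A i x)"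
    by (rule sum_component [symmetric]) (auto simp: finite_component)
  have "sign_twist A s (sign_twist A t y) = sign_twist A (\<lambda>d. s d + t d) y"
    if "y \<in> grd A i" for y i
    by (simp add: sign_twist_homogeneous [OF that] additive_sgn_pow_commute [OF additive_sign_twist]
      sgn_pow_sgn_pow add.commute)
  then have "sign_twist A s (sign_twist A t (component A i x)) = sign_twist A (\<lambda>d. s d + t d) (component A i x)"
    for i using component_in_grd by blast
  then show ?thesis
    by (subst (1 2) x) (simp add: additive.sum [OF additive_sign_twist])
qed

lemma sign_twist_even:
  assumes "\<And>d. even (s d)"
  shows "sign_twist A s x = x"
proof -
  have "sign_twist A s x = (\<Sum>i | component A i x \<noteq> 0. component A i x)"
    by (subst sign_twist_eq_sum) (auto simp: finite_component sgn_pow_def assms)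
  also have "\<dots> = x" by (rule sum_component) (auto simp: finite_component)
  finally show ?thesis .
qed

lemma suspension_twist_involution: "suspension_twist A (suspension_twist A xs) = xs"
  by (induction xs) (simp_all add: sign_twist_sign_twist sign_twist_even)

lemma suspend_suspend: "suspend A (suspend A f) = f"
  by (simp add: fun_eq_iff suspend_eq suspension_twist_involution)

section \<open>Graded multilinear maps and their brackets\<close>

text \<open>Multilinear maps on words in \<open>sH\<close> of degree \<open>g\<close>, with no reference to an arity. Values lie in \<open>H\<close>,
  one degree higher than in \<open>sH\<close>, whence the summand \<open>1\<close>.\<close>
definition suspended_cochain :: "int \<Rightarrow> 'a cochain \<Rightarrow> bool" where
  "suspended_cochain g F \<longleftrightarrow>
     (\<forall>us vs. linear_map (\<lambda>x. F (us @ x # vs))) \<and>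
     (\<forall>u. homogeneous_letters (grd A) u \<longrightarrow> F (map fst u) \<in> grd A (shifted_degree u + g + 1))"

lemma suspended_cochain_linear: "suspended_cochain g F \<Longrightarrow> linear_map (\<lambda>x. F (us @ x # vs))"
  by (simp add: suspended_cochain_def)

lemma suspended_cochain_degree:
  "suspended_cochain g F \<Longrightarrow> homogeneous_letters (grd A) u \<Longrightarrow>
     F (map fst u) \<in> grd A (shifted_degree u + g + 1)"
  by (simp add: suspended_cochain_def)

lemma suspended_cochain_multi_additive: "suspended_cochain g F \<Longrightarrow> multi_additive F"
  by (simp add: suspended_cochain_def multi_additive_def linear_map_iff)

lemma suspended_cochain_scale:
  "suspended_cochain g F \<Longrightarrow> F (us @ scl A c x # vs) = scl A c (F (us @ x # vs))"
  using suspended_cochain_linear [of g F us vs] by (simp add: linear_map_iff)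

lemma linear_map_zero: "linear_map (\<lambda>x. 0)"
  by (simp add: linear_map_iff additive_def)

lemma linear_map_add: "linear_map f \<Longrightarrow> linear_map g \<Longrightarrow> linear_map (\<lambda>x. f x + g x)"
  by (auto simp: linear_map_iff additive_def scale_right_distrib algebra_simps)

lemma linear_map_scale: "linear_map f \<Longrightarrow> linear_map (\<lambda>x. scl A c (f x))"
  by (auto simp: linear_map_iff additive_def scale_right_distrib mult.commute)

lemma linear_map_compose: "linear_map f \<Longrightarrow> linear_map g \<Longrightarrow> linear_map (\<lambda>x. f (g x))"
  by (auto simp: linear_map_iff additive_def)

lemma linear_map_deconc:
  "(\<And>a b. linear_map (\<lambda>x. \<Phi> x a b)) \<Longrightarrow> linear_map (\<lambda>x. deconc (\<Phi> x) xs)"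
  by (induction xs arbitrary: \<Phi>) (simp_all add: linear_map_add)

lemma deconc_in_grd:
  "(\<And>a b. a @ b = xs \<Longrightarrow> \<Phi> a b \<in> grd A d) \<Longrightarrow> deconc \<Phi> xs \<in> grd A d"
proof (induction xs arbitrary: \<Phi>)
  case (Cons x xs)
  have "deconc (\<lambda>a b. \<Phi> (x # a) b) xs \<in> grd A d"
    by (rule Cons.IH) (simp add: Cons.prems)
  then show ?case using Cons.prems [of "[]" "x # xs"] subspace_add [OF grd_subspace] by simp
qed simp

lemma homogeneous_letters_twist:
  assumes "homogeneous_letters (grd A) u"
  obtains u' where "homogeneous_letters (grd A) u'" "map snd u' = map snd u"
    "map fst u' = map (sign_twist A s) (map fst u)"
proof
  let ?u = "map (\<lambda>(x, d). (sign_twist A s x, d)) u"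
  show "homogeneous_letters (grd A) ?u"
    using assms sign_twist_in_grd by (auto simp: homogeneous_letters_def)
qed (auto simp: case_prod_beta)

lemma shifted_degree_cong:
  fixes u u' :: "('c \<times> int) list"
  shows "map snd u' = map snd u \<Longrightarrow> shifted_degree u' = shifted_degree u"
proof -
  have "shifted_degree w = (\<Sum>d\<leftarrow>map snd w. d - 1)" for w :: "('c \<times> int) list"
    by (simp add: comp_def)
  then show "map snd u' = map snd u \<Longrightarrow> shifted_degree u' = shifted_degree u" by (simp only:)
qed

lemma suspended_cochain_coder_pullback:
  assumes F: "suspended_cochain f F" and G: "suspended_cochain g G"
  shows "suspended_cochain (f + g) (coder_pullback (koszul_twist A e) G F)"
  unfolding suspended_cochain_def
proof (intro conjI allI impI)
  note lin = suspended_cochain_linear [OF F] suspended_cochain_linear [OF G]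
  fix us vs
  have right: "linear_map (\<lambda>x. F (a @ w # b @ x # c))" for a w b c
    using lin(1) [of "a @ w # b" c] by simp
  show "linear_map (\<lambda>x. coder_pullback (koszul_twist A e) G F (us @ x # vs))"
    unfolding coder_pullback_append_Cons
    by (intro linear_map_add linear_map_deconc right lin
      linear_map_compose [OF lin(1) lin(2)] linear_map_compose [OF lin(1) linear_sign_twist])
next
  fix u assume u: "homogeneous_letters (grd A) u"
  have "F (map (koszul_twist A e) (map fst u1) @ G (map fst u2) # map fst u3)
      \<in> grd A (shifted_degree u + (f + g) + 1)" if "u1 @ u2 @ u3 = u" for u1 u2 u3
  proof -
    have hom: "homogeneous_letters (grd A) u1" "homogeneous_letters (grd A) u2"
      "homogeneous_letters (grd A) u3" using u that by auto
    obtain u1' where u1': "homogeneous_letters (grd A) u1'" "map snd u1' = map snd u1"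
      "map fst u1' = map (koszul_twist A e) (map fst u1)"
      by (rule homogeneous_letters_twist [OF hom(1)])
    let ?w = "u1' @ (G (map fst u2), shifted_degree u2 + g + 1) # u3"
    have "homogeneous_letters (grd A) ?w"
      using hom u1' suspended_cochain_degree [OF G hom(2)] by simp
    then have "F (map fst ?w) \<in> grd A (shifted_degree ?w + f + 1)"
      by (rule suspended_cochain_degree [OF F])
    also have "shifted_degree ?w + f + 1 = shifted_degree u + (f + g) + 1"
      using shifted_degree_cong [OF u1'(2)] by (simp add: that [symmetric])
    finally show ?thesis by (simp add: u1'(3))
  qed
  then show "coder_pullback (koszul_twist A e) G F (map fst u) \<in> grd A (shifted_degree u + (f + g) + 1)"
    unfolding coder_pullback_def deconc_map by (intro deconc_in_grd) simp
qed

lemma suspended_cochain_zero: "suspended_cochain g 0"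
  by (simp add: suspended_cochain_def linear_map_zero subspace_0 [OF grd_subspace])

lemma suspended_cochain_add:
  "suspended_cochain g F \<Longrightarrow> suspended_cochain g G \<Longrightarrow> suspended_cochain g (F + G)"
  by (simp add: suspended_cochain_def linear_map_add subspace_add [OF grd_subspace])

lemma suspended_cochain_scale_cochain:
  "suspended_cochain g F \<Longrightarrow> suspended_cochain g (scale_cochain A c F)"
  by (simp add: suspended_cochain_def scale_cochain_def linear_map_scale subspace_scale [OF grd_subspace])

lemma scale_cochain_minus_one: "scale_cochain A (- 1) F = - F"
  by (simp add: fun_eq_iff scale_cochain_def)

lemma suspended_cochain_diff:
  "suspended_cochain g F \<Longrightarrow> suspended_cochain g G \<Longrightarrow> suspended_cochain g (F - G)"
  using suspended_cochain_add [of g F "- G"] suspended_cochain_scale_cochain [of g G "- 1"]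
  by (simp add: scale_cochain_minus_one)

lemma suspended_cochain_sgn_pow:
  "suspended_cochain g F \<Longrightarrow> suspended_cochain g (sgn_pow k F)"
  using suspended_cochain_scale_cochain [of g F "- 1"]
  by (simp add: sgn_pow_def scale_cochain_minus_one)

text \<open>A map of degree \<open>g\<close> commutes with the \<open>h\<close>-fold parity operator of \<open>sH\<close> up to \<open>(-1)^(g h)\<close>:
  this provides the sign hypothesis of the pre-Lie identity.\<close>
lemma suspended_cochain_koszul_twist:
  assumes G: "suspended_cochain g G"
  shows "G (map (koszul_twist A h) ys) = sgn_pow (g * h) (koszul_twist A h (G ys))"
proof (rule multi_additive_eqI)
  note lin = suspended_cochain_linear [OF G]
  show "multi_additive (\<lambda>ys. G (map (koszul_twist A h) ys))"
    using linear_map_compose [OF lin linear_sign_twist]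
    by (simp add: multi_additive_def linear_map_iff)
  show "multi_additive (\<lambda>ys. sgn_pow (g * h) (koszul_twist A h (G ys)))"
    using linear_map_compose [OF linear_sign_twist lin]
    by (auto simp: multi_additive_def linear_map_iff additive_def sgn_pow_plus)
  fix u assume u: "homogeneous_letters (grd A) u"
  have "G (map (koszul_twist A h) (map fst u)) = sgn_pow (h * shifted_degree u) (G (map fst u))"
    by (rule multi_additive_map_twist [OF suspended_cochain_multi_additive [OF G] u])
      (rule sign_twist_homogeneous)
  also have "\<dots> = sgn_pow (g * h) (koszul_twist A h (G (map fst u)))"
    unfolding sign_twist_homogeneous [OF suspended_cochain_degree [OF G u]] sgn_pow_sgn_pow
    by (rule sgn_pow_cong) (simp add: algebra_simps)
  finally show "G (map (koszul_twist A h) (map fst u))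
    = sgn_pow (g * h) (koszul_twist A h (G (map fst u)))" .
qed

text \<open>The commutator of the coderivations of \<open>F\<close> and \<open>G\<close>, corestricted.\<close>
definition suspended_bracket :: "int \<Rightarrow> int \<Rightarrow> 'a cochain \<Rightarrow> 'a cochain \<Rightarrow> 'a cochain" where
  "suspended_bracket f g F G =
     coder_pullback (koszul_twist A g) G F - sgn_pow (f * g) (coder_pullback (koszul_twist A f) F G)"

lemma suspended_cochain_bracket:
  assumes "suspended_cochain f F" and "suspended_cochain g G"
  shows "suspended_cochain (f + g) (suspended_bracket f g F G)"
  unfolding suspended_bracket_def
  using suspended_cochain_coder_pullback [OF assms] suspended_cochain_coder_pullback [OF assms(2,1)]
  by (intro suspended_cochain_diff suspended_cochain_sgn_pow) (simp_all add: add.commute)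

text \<open>The graded commutator of coderivations is the coderivation of the bracket, in the form
  \<open>F \<circ> [D\<^sub>G, D\<^sub>H] = F \<circ> D\<^bsub>[G, H]\<^esub>\<close>: the two double insertions of the pre-Lie identity cancel.\<close>
lemma coder_pullback_suspended_bracket:
  assumes F: "suspended_cochain f F" and G: "suspended_cochain g G" and H: "suspended_cochain h H"
  shows "coder_pullback (koszul_twist A (g + h)) (suspended_bracket g h G H) F =
    coder_pullback (koszul_twist A h) H (coder_pullback (koszul_twist A g) G F)
    - sgn_pow (g * h) (coder_pullback (koszul_twist A g) G (coder_pullback (koszul_twist A h) H F))"
proof -
  note ma = suspended_cochain_multi_additive
  let ?\<sigma> = "koszul_twist A g" and ?\<tau> = "koszul_twist A h" and ?T = "koszul_twist A (g + h)"
  have comp: "?\<sigma> (?\<tau> x) = ?T x" "?\<tau> (?\<sigma> x) = ?T x" for x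
    by (simp_all add: sign_twist_sign_twist algebra_simps)
  then have T: "?\<sigma> \<circ> ?\<tau> = ?T" "?\<tau> \<circ> ?\<sigma> = ?T" by auto
  let ?E = "double_insertion ?\<sigma> G ?\<tau> H F" and ?E' = "double_insertion ?\<tau> H ?\<sigma> G F"
  have "coder_pullback ?\<tau> H (coder_pullback ?\<sigma> G F) = coder_pullback ?T (coder_pullback ?\<tau> H G) F + sgn_pow (g * h) ?E + ?E'"
    using coder_pullback_twice [OF ma [OF F] ma [OF G], of ?\<sigma> ?\<tau> "g * h"]
      suspended_cochain_koszul_twist [OF G] comp T
    by (simp add: fun_eq_iff sgn_pow_fun_apply)
  moreover have "coder_pullback ?\<sigma> G (coder_pullback ?\<tau> H F) = coder_pullback ?T (coder_pullback ?\<sigma> G H) F + sgn_pow (g * h) ?E' + ?E"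
    using coder_pullback_twice [OF ma [OF F] ma [OF H], of ?\<tau> ?\<sigma> "g * h"]
      suspended_cochain_koszul_twist [OF H] comp T
    by (simp add: fun_eq_iff sgn_pow_fun_apply mult.commute)
  moreover have "coder_pullback ?T (suspended_bracket g h G H) F
      = coder_pullback ?T (coder_pullback ?\<tau> H G) F - sgn_pow (g * h) (coder_pullback ?T (coder_pullback ?\<sigma> G H) F)"
    unfolding suspended_bracket_def
      additive.diff [OF additive_coder_pullback_inserted [OF ma [OF F]]]
      additive_sgn_pow_commute [OF additive_coder_pullback_inserted [OF ma [OF F]]] ..
  moreover have "Z = X - sgn_pow k Y"
    if "X = P + sgn_pow k E + E'" "Y = Q + sgn_pow k E' + E" "Z = P - sgn_pow k Q"
    for X Y Z P Q E E' :: "'a cochain" and k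
    unfolding that by (simp add: sgn_pow_def)
  ultimately show ?thesis by blast
qed

text \<open>With brackets of coderivations rewritten as commutators, each side becomes a signed sum of iterated
  pullbacks. Of the eight terms on the right, \<open>G \<circ> D\<^sub>F \<circ> D\<^sub>H\<close> and \<open>H \<circ> D\<^sub>F \<circ> D\<^sub>G\<close>
  occur twice with opposite signs; the other four are the left-hand side.\<close>
lemma suspended_jacobi:
  assumes F: "suspended_cochain f F" and G: "suspended_cochain g G" and H: "suspended_cochain h H"
  shows "suspended_bracket f (g + h) F (suspended_bracket g h G H) =
    suspended_bracket (f + g) h (suspended_bracket f g F G) H
    + sgn_pow (f * g) (suspended_bracket g (f + h) G (suspended_bracket f h F H))"
proof -
  note expand = additive.diff [OF additive_coder_pullback] additive_sgn_pow_commute [OF additive_coder_pullback]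
  let ?C = "\<lambda>g G. coder_pullback (koszul_twist A g) G"
  have "suspended_bracket f (g + h) F (suspended_bracket g h G H) =
      ?C h H (?C g G F) - sgn_pow (g * h) (?C g G (?C h H F))
      - sgn_pow (f * (g + h)) (?C f F (?C h H G) - sgn_pow (g * h) (?C f F (?C g G H)))"
    unfolding suspended_bracket_def [of f "g + h"] coder_pullback_suspended_bracket [OF F G H]
    unfolding suspended_bracket_def expand ..
  moreover have "suspended_bracket (f + g) h (suspended_bracket f g F G) H =
      ?C h H (?C g G F) - sgn_pow (f * g) (?C h H (?C f F G))
      - sgn_pow ((f + g) * h) (?C g G (?C f F H) - sgn_pow (f * g) (?C f F (?C g G H)))"
    unfolding suspended_bracket_def [of "f + g" h] coder_pullback_suspended_bracket [OF H F G]
    unfolding suspended_bracket_def expand ..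
  moreover have "suspended_bracket g (f + h) G (suspended_bracket f h F H) =
      ?C h H (?C f F G) - sgn_pow (f * h) (?C f F (?C h H G))
      - sgn_pow (g * (f + h)) (?C g G (?C h H F) - sgn_pow (f * h) (?C g G (?C f F H)))"
    unfolding suspended_bracket_def [of g "f + h"] coder_pullback_suspended_bracket [OF G F H]
    unfolding suspended_bracket_def expand ..
  ultimately show ?thesis
    by (cases "even f"; cases "even g"; cases "even h") (simp_all add: sgn_pow_def)
qed


section \<open>The Gerstenhaber bracket of cochains\<close>

definition cochains :: "nat \<Rightarrow> int \<Rightarrow> 'a cochain set" where
  "cochains n j = {f. multilinear A n f \<and> has_internal_degree A n j f}"

lemma shifted_degree_eq: "shifted_degree u = sum_list (map snd u) - int (length u)"
  by (induction u) auto

text \<open>For words of length \<open>n\<close>, internal degree \<open>j\<close> is the same as degree \<open>n + j - 1\<close> after suspension,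
  which is the degree in the DGLA.\<close>
lemma cochains_iff:
  "f \<in> cochains n j \<longleftrightarrow>
     (\<forall>xs. length xs \<noteq> n \<longrightarrow> f xs = 0) \<and> suspended_cochain (int n + j - 1) f"
proof (intro iffI conjI)
  assume f: "f \<in> cochains n j"
  then show zero: "\<forall>xs. length xs \<noteq> n \<longrightarrow> f xs = 0"
    by (simp add: cochains_def multilinear_def)
  show "suspended_cochain (int n + j - 1) f"
    unfolding suspended_cochain_def
  proof (intro conjI allI impI)
    fix us vs
    show "linear_map (\<lambda>x. f (us @ x # vs))"
    proof (cases "length us + Suc (length vs) = n")
      case True
      have "\<forall>xs i. length xs = n \<and> i < n \<longrightarrow> linear_map (\<lambda>x. f (xs[i := x]))"
        using f by (simp add: cochains_def multilinear_def)
      from this [rule_format, of "us @ 0 # vs" "length us"] True show ?thesis by simp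
    qed (simp add: zero linear_map_zero)
  next
    fix u assume u: "homogeneous_letters (grd A) u"
    show "f (map fst u) \<in> grd A (shifted_degree u + (int n + j - 1) + 1)"
    proof (cases "length u = n")
      case True
      have "list_all2 (\<lambda>x d. x \<in> grd A d) (map fst u) (map snd u)"
        using u by (induction u) auto
      then have "f (map fst u) \<in> grd A (sum_list (map snd u) + j)"
        using f True by (simp add: cochains_def has_internal_degree_def)
      then show ?thesis using True by (simp add: shifted_degree_eq)
    qed (simp add: zero subspace_0 [OF grd_subspace])
  qed
next
  assume f: "(\<forall>xs. length xs \<noteq> n \<longrightarrow> f xs = 0) \<and> suspended_cochain (int n + j - 1) f"
  have "linear_map (\<lambda>x. f (xs[i := x]))" if "i < length xs" for xs i
    using suspended_cochain_linear [OF conjunct2 [OF f]] that by (simp add: upd_conv_take_nth_drop)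
  moreover have "f xs \<in> grd A (sum_list ds + j)"
    if "length xs = n" "list_all2 (\<lambda>x d. x \<in> grd A d) xs ds" for xs ds
  proof -
    have len: "length xs = length ds" using that(2) by (rule list_all2_lengthD)
    then have "homogeneous_letters (grd A) (zip xs ds)"
      using that(2) by (auto simp: homogeneous_letters_def list_all2_iff)
    from suspended_cochain_degree [OF conjunct2 [OF f] this] show ?thesis
      using that(1) len by (simp add: shifted_degree_eq)
  qed
  ultimately show "f \<in> cochains n j"
    using f by (auto simp: cochains_def multilinear_def has_internal_degree_def)
qed

lemma suspended_cochain_suspend:
  assumes "suspended_cochain g f"
  shows "suspended_cochain g (suspend A f)"
  unfolding suspended_cochain_def
proof (intro conjI allI impI)
  fix us vs
  obtain us' where "\<forall>x. suspension_twist A (us @ x # vs) =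
     us' @ sign_twist A (\<lambda>d. int (length vs) * d) x # suspension_twist A vs"
    using suspension_twist_append_Cons by blast
  then show "linear_map (\<lambda>x. suspend A f (us @ x # vs))"
    using linear_map_compose [OF suspended_cochain_linear [OF assms] linear_sign_twist]
    by (simp add: suspend_eq)
next
  fix u assume "homogeneous_letters (grd A) u"
  then have "\<exists>u'. homogeneous_letters (grd A) u' \<and> map snd u' = map snd u \<and>
      map fst u' = suspension_twist A (map fst u)"
  proof (induction u)
    case (Cons z u)
    then obtain u' where "homogeneous_letters (grd A) u'" "map snd u' = map snd u"
      "map fst u' = suspension_twist A (map fst u)" by auto
    then show ?case using Cons.prems
      by (intro exI [of _ "(sign_twist A (\<lambda>d. int (length u) * d) (fst z), snd z) # u'"])
        (simp add: sign_twist_in_grd)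
  qed simp
  then obtain u' where u': "homogeneous_letters (grd A) u'" "map snd u' = map snd u"
      "map fst u' = suspension_twist A (map fst u)" by blast
  show "suspend A f (map fst u) \<in> grd A (shifted_degree u + g + 1)"
    using suspended_cochain_degree [OF assms u'(1)]
    by (simp only: u'(3) suspend_eq shifted_degree_cong [OF u'(2)])
qed

lemma cochains_multi_additive: "f \<in> cochains n j \<Longrightarrow> multi_additive f"
  using suspended_cochain_multi_additive by (auto simp: cochains_iff)

lemma cochains_suspend: "f \<in> cochains n j \<Longrightarrow> suspend A f \<in> cochains n j"
  by (simp add: cochains_iff suspended_cochain_suspend) (simp add: suspend_eq)

lemma cochains_suspendD: "suspend A f \<in> cochains n j \<Longrightarrow> f \<in> cochains n j"
  using cochains_suspend [of "suspend A f"] by (simp add: suspend_suspend)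

lemma suspended_cochain_of_cochain:
  "f \<in> cochains n j \<Longrightarrow> suspended_cochain (total_degree (n, j)) (suspend A f)"
  using cochains_suspend by (simp add: cochains_iff total_degree_def)

lemma suspend_inject: "suspend A f = suspend A g \<Longrightarrow> f = g"
  by (metis suspend_suspend)

text \<open>Of all cuts into three parts, those whose middle part has the arity of \<open>G\<close> contribute, which
  leaves a sum over the position of that part.\<close>
lemma coderivation_comp_eq_coder_pullback:
  assumes F: "F \<in> cochains a i" and G: "G \<in> cochains b j"
  shows "coderivation_comp A a b e F G = coder_pullback (koszul_twist A e) G F"
proof
  fix xs :: "'a list"
  let ?T = "koszul_twist A e" and ?n = "length xs"
  let ?t = "\<lambda>k. F (map ?T (take k xs) @ [G (take b (drop k xs))] @ drop (k + b) xs)"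
  have F0: "F w = 0" if "length w \<noteq> a" for w using F that by (simp add: cochains_iff)
  have G0: "G w = 0" if "length w \<noteq> b" for w using G that by (simp add: cochains_iff)
  have F_zero: "F (u @ 0 # v) = 0" for u v
    by (rule additive.zero [OF multi_additiveD [OF cochains_multi_additive [OF F]]])
  have inner: "deconc (\<lambda>y z. F (map ?T (take k xs) @ G y # z)) (drop k xs)
      = (if k + b \<le> ?n then ?t k else 0)" if "k \<le> ?n" for k
  proof -
    have "deconc (\<lambda>y z. F (map ?T (take k xs) @ G y # z)) (drop k xs)
      = (\<Sum>l\<le>?n - k. if l = b then ?t k else 0)"
      unfolding deconc_eq_sum_take_drop length_drop
      by (rule sum.cong) (auto simp: G0 F_zero add.commute)
    then show ?thesis using that by (auto simp: le_diff_conv2 add.commute)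
  qed
  have "coder_pullback ?T G F xs = (\<Sum>k\<le>?n. if k + b \<le> ?n then ?t k else 0)"
    unfolding coder_pullback_def deconc_eq_sum_take_drop [of _ xs] by (rule sum.cong) (auto simp: inner)
  also have "\<dots> = coderivation_comp A a b e F G xs"
  proof (cases "Suc ?n = a + b")
    case True
    then have "{k. k \<le> ?n \<and> k + b \<le> ?n} = {..<a}" by auto
    then show ?thesis
      using True by (simp add: coderivation_comp_def sum.If_cases Int_def)
  next
    case False
    have "(if k + b \<le> ?n then ?t k else 0) = 0" for k
      using False by (auto intro: F0)
    then show ?thesis using False by (simp add: coderivation_comp_def)
  qed
  finally show "coderivation_comp A a b e F G xs = coder_pullback ?T G F xs" by simp
qed

lemma suspend_bracket:
  assumes "f \<in> cochains (fst q) (snd q)" and "g \<in> cochains (fst r) (snd r)"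
  shows "suspend A (bracket A q r f g) =
    suspended_bracket (total_degree q) (total_degree r) (suspend A f) (suspend A g)"
proof -
  note c = cochains_suspend [OF assms(1)] cochains_suspend [OF assms(2)]
  have "suspend A (bracket A q r f g) = suspend A (circ A q r f g)
      - sgn_pow (total_degree q * total_degree r) (suspend A (circ A r q g f))"
    by (simp add: fun_eq_iff suspend_eq bracket_def sgn_pow_fun_apply)
  then show ?thesis
    by (simp add: circ_def suspend_suspend suspended_bracket_def
      coderivation_comp_eq_coder_pullback [OF c] coderivation_comp_eq_coder_pullback [OF c(2,1)])
qed

lemma bracket_in_cochains:
  assumes f: "f \<in> cochains a i" and g: "g \<in> cochains b j" and "0 < a + b"
  shows "bracket A (a, i) (b, j) f g \<in> cochains (a + b - 1) (i + j)"
proof (rule cochains_suspendD, unfold cochains_iff, intro conjI allI impI)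
  note c = cochains_suspend [OF f] cochains_suspend [OF g]
  have "int (a + b - 1) + (i + j) - 1 = total_degree (a, i) + total_degree (b, j)"
    using \<open>0 < a + b\<close> unfolding total_degree_def fst_conv snd_conv by arith
  then show "suspended_cochain (int (a + b - 1) + (i + j) - 1) (suspend A (bracket A (a, i) (b, j) f g))"
    using suspended_cochain_bracket [OF suspended_cochain_of_cochain [OF f] suspended_cochain_of_cochain [OF g]]
      suspend_bracket [of f "(a, i)" g "(b, j)"] f g
    by simp
next
  fix xs :: "'a list" assume "length xs \<noteq> a + b - 1"
  then show "suspend A (bracket A (a, i) (b, j) f g) xs = 0"
    using \<open>0 < a + b\<close>
    by (auto simp: suspend_eq bracket_def circ_def coderivation_comp_def sgn_pow_fun_apply
      suspension_twist_involution)
qed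

lemma suspend_add: "suspend A (f + g) = suspend A f + suspend A g"
  by (simp add: fun_eq_iff suspend_eq)

lemma suspend_scale: "suspend A (scale_cochain A c f) = scale_cochain A c (suspend A f)"
  by (simp add: fun_eq_iff suspend_eq scale_cochain_def)

lemma additive_circ_left: "additive (\<lambda>f. circ A q r f g)"
proof
  fix f f'
  have "coderivation_comp A a b e (F + F') G = coderivation_comp A a b e F G + coderivation_comp A a b e F' G"
    for a b e F F' G
    by (simp add: fun_eq_iff coderivation_comp_def sum.distrib)
  then show "circ A q r (f + f') g = circ A q r f g + circ A q r f' g"
    by (simp only: circ_def suspend_add)
qed

lemma additive_circ_right:
  assumes "f \<in> cochains n j"
  shows "additive (circ A q r f)"
proof
  fix g g'
  let ?F = "suspend A f"
  have "?F (u @ (x + y) # v) = ?F (u @ x # v) + ?F (u @ y # v)" for u v x y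
    using additive.add [OF multi_additiveD [OF cochains_multi_additive [OF cochains_suspend [OF assms]]]] .
  then have "coderivation_comp A a b e ?F (G + G') =
      coderivation_comp A a b e ?F G + coderivation_comp A a b e ?F G'" for a b e G G'
    by (simp add: fun_eq_iff coderivation_comp_def sum.distrib)
  then show "circ A q r f (g + g') = circ A q r f g + circ A q r f g'"
    by (simp only: circ_def suspend_add)
qed

lemma additive_bracket_left: "g \<in> cochains n j \<Longrightarrow> additive (\<lambda>f. bracket A q r f g)"
  using additive.add [OF additive_circ_left] additive.add [OF additive_circ_right]
  by unfold_locales (simp add: bracket_def sgn_pow_plus)

lemma additive_bracket_right: "f \<in> cochains n j \<Longrightarrow> additive (bracket A q r f)"
  using additive.add [OF additive_circ_left] additive.add [OF additive_circ_right]
  by unfold_locales (simp add: bracket_def sgn_pow_plus)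

lemma bracket_scale_right:
  assumes "f \<in> cochains n j"
  shows "bracket A q r f (scale_cochain A c g) = scale_cochain A c (bracket A q r f g)"
proof -
  let ?F = "suspend A f"
  have "?F (u @ scl A c x # v) = scl A c (?F (u @ x # v))" for u v x
    using suspended_cochain_scale [OF suspended_cochain_of_cochain [OF assms]] .
  then have "coderivation_comp A a b e ?F (scale_cochain A c G) = scale_cochain A c (coderivation_comp A a b e ?F G)"
    for a b e G
    by (simp add: fun_eq_iff coderivation_comp_def scale_cochain_def scale_sum_right)
  then have "circ A q r f (scale_cochain A c g) = scale_cochain A c (circ A q r f g)"
    by (simp only: circ_def suspend_scale)
  moreover have "coderivation_comp A a b e (scale_cochain A c G) ?F = scale_cochain A c (coderivation_comp A a b e G ?F)"
    for a b e G
    by (simp add: fun_eq_iff coderivation_comp_def scale_cochain_def scale_sum_right)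
  then have "circ A r q (scale_cochain A c g) f = scale_cochain A c (circ A r q g f)"
    by (simp only: circ_def suspend_scale)
  ultimately show ?thesis
    by (simp add: fun_eq_iff bracket_def scale_cochain_def sgn_pow_fun_apply
      scale_right_diff_distrib additive_sgn_pow_commute [OF additive_scl])
qed

lemma bracket_odd_commute:
  "odd (total_degree q) \<Longrightarrow> bracket A q q f g = bracket A q q g f"
  by (simp add: bracket_def sgn_pow_def)

lemma mul_cochain_in_cochains: "mul_cochain A \<in> cochains 2 0"
  unfolding cochains_def multilinear_def has_internal_degree_def
proof (intro CollectI conjI allI impI)
  fix xs :: "'a list" assume "length xs \<noteq> 2"
  then show "mul_cochain A xs = 0"
    by (auto simp: mul_cochain_def split: list.splits)
next
  fix xs :: "'a list" and i :: nat assume "length xs = 2 \<and> i < 2"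
  then obtain x y where "xs = [x, y]" "i = 0 \<or> i = 1"
    by (auto simp: numeral_2_eq_2 length_Suc_conv less_Suc_eq)
  then show "linear_map (\<lambda>x. mul_cochain A (xs[i := x]))"
    using mul_linear_left mul_linear_right by (auto simp: mul_cochain_def)
next
  fix xs :: "'a list" and ds :: "int list"
  assume "length xs = 2 \<and> list_all2 (\<lambda>x d. x \<in> grd A d) xs ds"
  then show "mul_cochain A xs \<in> grd A (sum_list ds + 0)"
    using mul_degree by (auto simp: numeral_2_eq_2 length_Suc_conv list_all2_Cons1 mul_cochain_def)
qed

lemma harrison_diff_in_cochains:
  assumes "f \<in> cochains a i"
  shows "harrison_diff A (a, i) f \<in> cochains (a + 1) i"
  using bracket_in_cochains [OF mul_cochain_in_cochains assms] by (simp add: harrison_diff_def)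

lemma additive_harrison_diff: "additive (harrison_diff A q)"
  unfolding harrison_diff_def [abs_def] by (rule additive_bracket_right [OF mul_cochain_in_cochains])

text \<open>The differential is a bracket with the multiplication, so it is a derivation of the bracket by the
  Jacobi identity.\<close>
theorem harrison_diff_bracket:
  assumes f: "f \<in> cochains a i" and g: "g \<in> cochains b j" and pos: "0 < a + b"
  shows "harrison_diff A (a + b - 1, i + j) (bracket A (a, i) (b, j) f g) =
    bracket A (a + 1, i) (b, j) (harrison_diff A (a, i) f) g
    + sgn_pow (total_degree (a, i)) (bracket A (a, i) (b + 1, j) f (harrison_diff A (b, j) g))"
    (is "?l = ?r + sgn_pow _ ?r'")
proof (rule suspend_inject)
  let ?M = "suspend A (mul_cochain A)" and ?F = "suspend A f" and ?G = "suspend A g"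
  let ?g = "total_degree (a, i)" and ?h = "total_degree (b, j)"
  note m = mul_cochain_in_cochains
  have deg: "total_degree (2, 0) = 1" "total_degree (a + b - 1, i + j) = ?g + ?h"
    "total_degree (a + 1, i) = 1 + ?g" "total_degree (b + 1, j) = 1 + ?h"
    using pos unfolding total_degree_def fst_conv snd_conv by auto
  have diff: "suspend A (harrison_diff A (n, k) u) =
      suspended_bracket 1 (total_degree (n, k)) ?M (suspend A u)" if "u \<in> cochains n k" for n k u
    unfolding harrison_diff_def using suspend_bracket [of _ "(2, 0)" u "(n, k)"] m that by (simp add: deg)
  have fg: "suspend A (bracket A (a, i) (b, j) f g) = suspended_bracket ?g ?h ?F ?G"
    using suspend_bracket [of f "(a, i)" g "(b, j)"] f g by simp
  have "suspend A ?l = suspended_bracket 1 (?g + ?h) ?M (suspended_bracket ?g ?h ?F ?G)"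
    by (simp only: diff [OF bracket_in_cochains [OF f g pos]] deg fg)
  moreover have "suspend A ?r = suspended_bracket (1 + ?g) ?h (suspended_bracket 1 ?g ?M ?F) ?G"
    using suspend_bracket [of "harrison_diff A (a, i) f" "(a + 1, i)" g "(b, j)"]
      harrison_diff_in_cochains [OF f] g deg by (simp add: diff [OF f])
  moreover have "suspend A ?r' = suspended_bracket ?g (1 + ?h) ?F (suspended_bracket 1 ?h ?M ?G)"
    using suspend_bracket [of f "(a, i)" "harrison_diff A (b, j) g" "(b + 1, j)"]
      harrison_diff_in_cochains [OF g] f deg by (simp add: diff [OF g])
  moreover have "suspend A (?r + sgn_pow ?g ?r') = suspend A ?r + sgn_pow ?g (suspend A ?r')"
    by (simp add: fun_eq_iff suspend_eq sgn_pow_fun_apply)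
  moreover have "suspended_cochain 1 ?M"
    using suspended_cochain_of_cochain [OF m] by (simp add: deg)
  ultimately show "suspend A ?l = suspend A (?r + sgn_pow ?g ?r')"
    using suspended_jacobi [of 1 ?M ?g ?F ?h ?G]
      suspended_cochain_of_cochain [OF f] suspended_cochain_of_cochain [OF g] by simp
qed

section \<open>Harrison cochains\<close>

text \<open>A cochain vanishes off its arity, hence on shuffles of words of any other total length.\<close>
lemma harrison_cochains_iff:
  "f \<in> harrison_cochains A n j \<longleftrightarrow> f \<in> cochains n j \<and>
    (\<forall>u v. u \<noteq> [] \<longrightarrow> v \<noteq> [] \<longrightarrow> homogeneous_letters (grd A) u \<longrightarrow> homogeneous_letters (grd A) v
       \<longrightarrow> shuffle_eval (suspend A f) u v = 0)" (is "_ = (_ \<and> ?V)")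
proof -
  have "vanishes_on_shuffles A n (suspend A f) \<longleftrightarrow> ?V" if "f \<in> cochains n j"
  proof -
    have "shuffle_eval (suspend A f) u v = 0" if "length u + length v \<noteq> n" for u v
      using cochains_suspend [OF \<open>f \<in> cochains n j\<close>] that
      by (intro shuffle_eval_zero) (simp add: cochains_iff)
    moreover have "(\<forall>(x, d) \<in> set u \<union> set v. x \<in> grd A d) \<longleftrightarrow>
        homogeneous_letters (grd A) u \<and> homogeneous_letters (grd A) v" for u v
      by (simp add: homogeneous_letters_def ball_Un)
    ultimately show ?thesis
      unfolding vanishes_on_shuffles_def by (simp only:) metis
  qed
  then show ?thesis unfolding harrison_cochains_def cochains_def by auto
qed

lemma harrison_cochains_subset: "f \<in> harrison_cochains A n j \<Longrightarrow> f \<in> cochains n j"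
  by (simp add: harrison_cochains_iff)

lemma cochains_add: "f \<in> cochains n j \<Longrightarrow> g \<in> cochains n j \<Longrightarrow> f + g \<in> cochains n j"
  by (simp add: cochains_iff suspended_cochain_add)

lemma cochains_scale: "f \<in> cochains n j \<Longrightarrow> scale_cochain A c f \<in> cochains n j"
  by (simp add: cochains_iff suspended_cochain_scale_cochain) (simp add: scale_cochain_def)

lemma harrison_cochains_add:
  "f \<in> harrison_cochains A n j \<Longrightarrow> g \<in> harrison_cochains A n j \<Longrightarrow> f + g \<in> harrison_cochains A n j"
  by (simp add: harrison_cochains_iff cochains_add suspend_eq [abs_def] shuffle_eval_add)

lemma harrison_cochains_scale:
  "f \<in> harrison_cochains A n j \<Longrightarrow> scale_cochain A c f \<in> harrison_cochains A n j"
  by (auto simp: harrison_cochains_iff cochains_scale)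
    (simp add: suspend_eq [abs_def] scale_cochain_def additive_shuffle_eval [OF additive_scl, symmetric])

lemma harrison_cochains_diff:
  "f \<in> harrison_cochains A n j \<Longrightarrow> g \<in> harrison_cochains A n j \<Longrightarrow> f - g \<in> harrison_cochains A n j"
  using harrison_cochains_add [of f n j "- g"] harrison_cochains_scale [of g n j "- 1"]
  by (simp add: scale_cochain_minus_one)

text \<open>\<open>F \<circ> D\<^sub>G\<close> sends \<open>u * v\<close> to \<open>F\<close> evaluated on \<open>D\<^sub>G u * v\<close> and \<open>u * D\<^sub>G v\<close>, which are again shuffles
  of nonempty words, as every word in \<open>D\<^sub>G u\<close> contains the letter produced by \<open>G\<close>.\<close>
lemma coder_pullback_kills_shuffles:
  assumes F: "f \<in> harrison_cochains A a i" and G: "g \<in> harrison_cochains A b j" and "0 < b"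
    and u: "u \<noteq> []" "homogeneous_letters (grd A) u" and v: "v \<noteq> []" "homogeneous_letters (grd A) v"
  shows "shuffle_eval (coder_pullback (koszul_twist A (total_degree (b, j))) (suspend A g) (suspend A f)) u v = 0"
proof -
  let ?F = "suspend A f" and ?G = "suspend A g" and ?g = "total_degree (b, j)"
  have kill: "shuffle_eval ?F u v = 0" "shuffle_eval ?G u v = 0"
    if "u \<noteq> []" "v \<noteq> []" "homogeneous_letters (grd A) u" "homogeneous_letters (grd A) v" for u v
    using F G that by (auto simp: harrison_cochains_iff)
  have cF: "f \<in> cochains a i" and cG: "g \<in> cochains b j"
    using F G by (simp_all add: harrison_cochains_subset)
  have "?G [] = 0"
    using cochains_suspend [OF cG] \<open>0 < b\<close> by (simp add: cochains_iff)
  let ?L = "deconc (\<lambda>u1 r. deconc (\<lambda>u2 u3. sgn_pow (?g * shifted_degree u1)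
      (shuffle_eval ?F (u1 @ (?G (map fst u2), shifted_degree u2 + ?g + 1) # u3) v)) r) u"
  let ?R = "deconc (\<lambda>v1 r. deconc (\<lambda>v2 v3. sgn_pow (?g * shifted_degree v1)
      (shuffle_eval ?F u (v1 @ (?G (map fst v2), shifted_degree v2 + ?g + 1) # v3))) r) v"
  have eq: "shuffle_eval (coder_pullback (koszul_twist A ?g) ?G ?F) u v = ?L + sgn_pow (?g * shifted_degree u) ?R"
    by (rule shuffle_eval_coder_pullback [where gr = "grd A"])
      (use cochains_multi_additive [OF cochains_suspend [OF cF]] \<open>?G [] = 0\<close> kill(2)
        sign_twist_homogeneous u(2) v(2) in blast)+
  have insert: "homogeneous_letters (grd A)
      (w1 @ (?G (map fst w2), shifted_degree w2 + ?g + 1) # w3)"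
    if "w1 @ w2 @ w3 = w" "homogeneous_letters (grd A) w" for w1 w2 w3 w
    using that suspended_cochain_degree [OF suspended_cochain_of_cochain [OF cG]] by auto
  have left: "shuffle_eval ?F (u1 @ (?G (map fst u2), shifted_degree u2 + ?g + 1) # u3) v = 0"
    if "u1 @ r = u" "u2 @ u3 = r" for u1 u2 u3 r
    using insert [of u1 u2 u3 u] that u v by (intro kill(1)) auto
  have right: "shuffle_eval ?F u (v1 @ (?G (map fst v2), shifted_degree v2 + ?g + 1) # v3) = 0"
    if "v1 @ r = v" "v2 @ v3 = r" for v1 v2 v3 r
    using insert [of v1 v2 v3 v] that u v by (intro kill(1)) auto
  have "?L = deconc (\<lambda>u1 r. deconc (\<lambda>u2 u3. 0) r) u"
    by (intro deconc_cong) (simp only: left sgn_pow_zero)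
  moreover have "?R = deconc (\<lambda>v1 r. deconc (\<lambda>v2 v3. 0) r) v"
    by (intro deconc_cong) (simp only: right sgn_pow_zero)
  ultimately show ?thesis unfolding eq by (simp only: deconc_zero sgn_pow_zero add_0)
qed

theorem bracket_in_harrison_cochains:
  assumes f: "f \<in> harrison_cochains A a i" and g: "g \<in> harrison_cochains A b j" and "0 < a" "0 < b"
  shows "bracket A (a, i) (b, j) f g \<in> harrison_cochains A (a + b - 1) (i + j)"
proof -
  have c: "f \<in> cochains a i" "g \<in> cochains b j"
    using f g by (simp_all add: harrison_cochains_subset)
  have "shuffle_eval (suspend A (bracket A (a, i) (b, j) f g)) u v = 0"
    if uv: "u \<noteq> []" "v \<noteq> []" "homogeneous_letters (grd A) u" "homogeneous_letters (grd A) v" for u v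
  proof -
    let ?g = "total_degree (a, i)" and ?h = "total_degree (b, j)"
    let ?X = "coder_pullback (koszul_twist A ?h) (suspend A g) (suspend A f)"
    let ?Y = "coder_pullback (koszul_twist A ?g) (suspend A f) (suspend A g)"
    have "suspend A (bracket A (a, i) (b, j) f g) = (\<lambda>w. ?X w + sgn_pow (?g * ?h + 1) (?Y w))"
      using suspend_bracket [of f "(a, i)" g "(b, j)"] c
      by (auto simp: fun_eq_iff suspended_bracket_def sgn_pow_fun_apply sgn_pow_def)
    then show ?thesis
      using coder_pullback_kills_shuffles [OF f g] coder_pullback_kills_shuffles [OF g f] uv \<open>0 < a\<close> \<open>0 < b\<close>
      by (simp add: shuffle_eval_add shuffle_eval_sgn_pow)
  qed
  then show ?thesis
    using bracket_in_cochains [OF c] \<open>0 < a\<close> by (simp add: harrison_cochains_iff)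
qed

end

section \<open>Low arities of the complete DGLA\<close>

lemma dgla_bracket_2: "dgla_bracket A d e F G 2 = 0"
proof -
  have "{(a, b). (2::nat) \<le> a \<and> 2 \<le> b \<and> a + b = 2 + 1} = {}" by auto
  then show ?thesis unfolding dgla_bracket_def by (simp only: sum.empty)
qed

lemma dgla_bracket_3:
  "dgla_bracket A d e F G 3 = bracket A (2, d - 1) (2, e - 1) (F 2) (G 2)"
proof -
  have "{(a, b). (2::nat) \<le> a \<and> 2 \<le> b \<and> a + b = 3 + 1} = {(2, 2)}" by auto
  then show ?thesis unfolding dgla_bracket_def by simp
qed

lemma dgla_bracket_4:
  "dgla_bracket A d e F G 4 =
     bracket A (2, d - 1) (3, e - 2) (F 2) (G 3) + bracket A (3, d - 2) (2, e - 1) (F 3) (G 2)"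
proof -
  have "{(a, b). (2::nat) \<le> a \<and> 2 \<le> b \<and> a + b = 4 + 1} = {(2, 3), (3, 2)}" by auto
  then show ?thesis unfolding dgla_bracket_def by simp
qed

lemma dgla_bracket_5:
  "dgla_bracket A d e F G 5 =
     bracket A (2, d - 1) (4, e - 3) (F 2) (G 4) + bracket A (3, d - 2) (3, e - 2) (F 3) (G 3)
     + bracket A (4, d - 3) (2, e - 1) (F 4) (G 2)"
proof -
  have "{(a, b). (2::nat) \<le> a \<and> 2 \<le> b \<and> a + b = 5 + 1} = {(2, 4), (3, 3), (4, 2)}" by auto
  then show ?thesis unfolding dgla_bracket_def by (simp add: add.assoc)
qed

context fd_graded_comm_algebra
begin

lemma zero_in_cochains: "0 \<in> cochains n j"
  by (simp add: cochains_iff suspended_cochain_zero)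

lemma bracket_zero_left: "g \<in> cochains n j \<Longrightarrow> bracket A q r 0 g = 0"
  by (rule additive.zero [OF additive_bracket_left])

lemma bracket_zero_right: "f \<in> cochains n j \<Longrightarrow> bracket A q r f 0 = 0"
  by (rule additive.zero [OF additive_bracket_right])

lemma filtration_component:
  "F \<in> filtration A d s \<Longrightarrow> 2 \<le> n \<Longrightarrow> s + 1 \<le> n \<Longrightarrow> F n \<in> harrison_cochains A n (d + 1 - int n)"
  unfolding filtration_def by (auto dest: spec [of _ n])

lemma filtration_component_zero: "F \<in> filtration A d s \<Longrightarrow> n \<le> s \<Longrightarrow> F n = 0"
  unfolding filtration_def by (auto dest: spec [of _ n])

lemma enhancement_component:
  assumes "minimal_Cinf_enhancement A m"
  shows "m 2 = 0" "m 3 \<in> harrison_cochains A 3 (- 1)" "m 4 \<in> harrison_cochains A 4 (- 2)"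
proof -
  have "m \<in> filtration A 1 2" using assms by (simp add: minimal_Cinf_enhancement_def)
  then show "m 2 = 0" "m 3 \<in> harrison_cochains A 3 (- 1)" "m 4 \<in> harrison_cochains A 4 (- 2)"
    using filtration_component [of m 1 2 3] filtration_component [of m 1 2 4]
      filtration_component_zero [of m 1 2 2] by simp_all
qed

text \<open>The Maurer-Cartan equation in arities 4 and 5.\<close>
lemma enhancement_diff:
  assumes m: "minimal_Cinf_enhancement A m"
  shows "harrison_diff A (3, - 1) (m 3) = 0"
    and "harrison_diff A (4, - 2) (m 4) = - scale_cochain A (1 / 2) (bracket A (3, - 1) (3, - 1) (m 3) (m 3))"
proof -
  note c = enhancement_component [OF m]
  note m3 = harrison_cochains_subset [OF c(2)] and m4 = harrison_cochains_subset [OF c(3)]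
  have MC: "dgla_diff A 1 m n + scale_cochain A (1 / 2) (dgla_bracket A 1 1 m m n) = 0" for n
  proof -
    have "(dgla_diff A 1 m + scale_product A (1 / 2) (dgla_bracket A 1 1 m m)) n = 0"
      using m by (simp add: minimal_Cinf_enhancement_def)
    then show ?thesis by (simp add: scale_product_def)
  qed
  note zeros = c(1) mul_element_def bracket_zero_left [OF zero_in_cochains]
    bracket_zero_left [OF m3] bracket_zero_left [OF m4] bracket_zero_right [OF m3] bracket_zero_right [OF m4]
  have "scale_cochain A (1 / 2) 0 = 0"
    by (simp add: fun_eq_iff scale_cochain_def)
  then show "harrison_diff A (3, - 1) (m 3) = 0"
    using MC [of 4] by (simp add: dgla_diff_def dgla_bracket_4 zeros harrison_diff_def)
  show "harrison_diff A (4, - 2) (m 4) = - scale_cochain A (1 / 2) (bracket A (3, - 1) (3, - 1) (m 3) (m 3))"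
    using MC [of 5] by (simp add: dgla_diff_def dgla_bracket_5 zeros harrison_diff_def eq_neg_iff_add_eq_0)
qed

end

text \<open>In arity 3 both exponential series stop after the term with no bracket: bracketing with \<open>p\<close> raises
  the arity, and nothing of arity 2 is there to be raised.\<close>
lemma gauge_action_3:
  assumes "fd_graded_comm_algebra A" and p: "p \<in> filtration A 0 1" and m2: "m 2 = 0"
  shows "gauge_action A p m 3 = m 3 - harrison_diff A (2, - 1) (p 2)"
proof
  interpret fd_graded_comm_algebra A by fact
  fix xs
  have p2: "p 2 \<in> cochains 2 (- 1)"
    using filtration_component [OF p, of 2] harrison_cochains_subset by simp
  let ?ad = "dgla_bracket A 0 1 p"
  have ad: "(?ad ^^ Suc j) X 3 = 0" if "X 2 = 0" for j X
  proof -
    have "(?ad ^^ j) X 2 = 0" using that by (cases j) (simp_all add: dgla_bracket_2)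
    then show ?thesis by (simp add: dgla_bracket_3 bracket_zero_right [OF p2])
  qed
  have series: "Sum_any (\<lambda>j. scl A (1 / fact (j + k)) ((?ad ^^ j) X 3 xs)) = scl A (1 / fact k) (X 3 xs)"
    if "X 2 = 0" for X k
  proof -
    have "Sum_any (\<lambda>j. scl A (1 / fact (j + k)) ((?ad ^^ j) X 3 xs))
        = Sum_any (\<lambda>j::nat. if j = 0 then scl A (1 / fact k) (X 3 xs) else 0)"
    proof (rule Sum_any.cong)
      fix j
      show "scl A (1 / fact (j + k)) ((?ad ^^ j) X 3 xs)
          = (if j = 0 then scl A (1 / fact k) (X 3 xs) else 0)"
        using ad [where X = X, OF that] by (cases j) (simp_all del: funpow.simps(2))
    qed
    also have "\<dots> = scl A (1 / fact k) (X 3 xs)"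
      by (rule Sum_any.delta)
    finally show ?thesis .
  qed
  have "dgla_diff A 0 p 2 = 0" by (simp add: dgla_diff_def dgla_bracket_2)
  moreover have "dgla_diff A 0 p 3 = harrison_diff A (2, - 1) (p 2)"
    by (simp add: dgla_diff_def dgla_bracket_3 mul_element_def harrison_diff_def)
  ultimately show "gauge_action A p m 3 xs = (m 3 - harrison_diff A (2, - 1) (p 2)) xs"
    using m2 series [of m 0] series [of "dgla_diff A 0 p" 1] by (simp add: gauge_action_def)
qed

lemma scale_half_double:
  fixes A :: "('k::field_char_0, 'a::ab_group_add) graded_algebra"
  assumes "fd_graded_comm_algebra A"
  shows "scale_cochain A (1 / 2) f + scale_cochain A (1 / 2) f = f"
proof -
  interpret fd_graded_comm_algebra A by fact
  show ?thesis
    by (simp add: fun_eq_iff scale_cochain_def scale_left_distrib [symmetric])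
qed

theorem lemma4p11:
  fixes A :: "('k::field_char_0, 'a::ab_group_add) graded_algebra"
    and m m' p :: "'a product_cochain"
  assumes "fd_graded_comm_algebra A"
    and "minimal_Cinf_enhancement A m"
    and "minimal_Cinf_enhancement A m'"
    and "isotopic_mod A 3 m m'"
    and "p \<in> filtration A 0 1"
    and "cong_mod_filtration A 3 (gauge_action A p m) m'"
  shows "m' 3 = m 3 - harrison_diff A (2, -1) (p 2)
    \<and> kappa4 A (p 2) m m' \<in> harrison_cocycles A 4 (-2)"
proof -
  interpret fd_graded_comm_algebra A by fact
  note m = enhancement_component [OF assms(2)] enhancement_diff [OF assms(2)]
  note m' = enhancement_component [OF assms(3)] enhancement_diff [OF assms(3)]
  let ?B = "bracket A (3, -1) (3, -1)" and ?h = "scale_cochain A (1 / 2)"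
  let ?P = "bracket A (2, -1) (3, -1) (p 2)" and ?\<delta> = "harrison_diff A (4, -2)"
  define D where "D = harrison_diff A (2, -1) (p 2)"
  have "(gauge_action A p m - m') 3 = 0"
    using assms(6) unfolding cong_mod_filtration_def by (rule filtration_component_zero) simp
  then have m'3: "m' 3 = m 3 - D"
    by (simp add: gauge_action_3 [where m = m, OF assms(1,5) m(1)] D_def)
  have p2: "p 2 \<in> harrison_cochains A 2 (- 1)"
    using filtration_component [OF assms(5), of 2] by simp
  have D: "D \<in> harrison_cochains A 3 (- 1)"
    using harrison_cochains_diff [OF m(2) m'(2)] by (simp add: m'3)
  note c = harrison_cochains_subset [OF p2] harrison_cochains_subset [OF m(2)] harrison_cochains_subset [OF D]
  \<comment> \<open>\<open>D\<close> is a difference of two cocycles.\<close>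
  have diff_D: "harrison_diff A (3, -1) D = 0"
    using m(4) m'(4) by (simp add: m'3 additive.diff [OF additive_harrison_diff])
  have P: "?P X \<in> harrison_cochains A 4 (- 2)" if "X \<in> harrison_cochains A 3 (- 1)" for X
    using bracket_in_harrison_cochains [OF p2 that] by simp
  have kappa: "kappa4 A (p 2) m m' = m 4 - m' 4 + ?P (m 3) - ?h (?P D)"
    by (simp add: kappa4_def D_def)
  \<comment> \<open>\<open>p 2\<close> has degree 0, so that the Leibniz rule carries no sign.\<close>
  have diff_P: "?\<delta> (?P X) = ?B D X"
    if "X \<in> cochains 3 (- 1)" "harrison_diff A (3, -1) X = 0" for X
    using harrison_diff_bracket [OF c(1) that(1)] that(2)
    by (simp add: total_degree_def bracket_zero_right [OF c(1)] D_def)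
  have "?\<delta> (kappa4 A (p 2) m m') = ?\<delta> (m 4) - ?\<delta> (m' 4) + ?\<delta> (?P (m 3)) - ?h (?\<delta> (?P D))"
    unfolding kappa additive.diff [OF additive_harrison_diff] additive.add [OF additive_harrison_diff]
    by (simp add: harrison_diff_def bracket_scale_right [OF mul_cochain_in_cochains])
  also have "\<dots> = ?h (?B (m' 3) (m' 3)) - ?h (?B (m 3) (m 3)) + ?B D (m 3) - ?h (?B D D)"
    using diff_P [OF c(2) m(4)] diff_P [OF c(3) diff_D] m(5) m'(5) by simp
  \<comment> \<open>The bracket of two elements of degree 1 is symmetric, so the mixed terms agree.\<close>
  also have "?B (m' 3) (m' 3) = ?B (m 3) (m 3) - ?B D (m 3) - ?B D (m 3) + ?B D D"
  proof -
    have "?B (m 3 - D) (m 3 - D) = ?B (m 3) (m 3) - ?B (m 3) D - (?B D (m 3) - ?B D D)"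
      using harrison_cochains_subset [OF m'(2), unfolded m'3]
      by (simp only: additive.diff [OF additive_bracket_left] additive.diff [OF additive_bracket_right [OF c(2)]]
        additive.diff [OF additive_bracket_right [OF c(3)]])
    moreover have "?B (m 3) D = ?B D (m 3)"
      by (rule bracket_odd_commute) (simp add: total_degree_def)
    ultimately show ?thesis by (simp add: m'3)
  qed
  also have "?h (\<dots>) = ?h (?B (m 3) (m 3)) - ?h (?B D (m 3)) - ?h (?B D (m 3)) + ?h (?B D D)"
    by (simp add: fun_eq_iff scale_cochain_def scale_right_diff_distrib scale_right_distrib)
  finally have "?\<delta> (kappa4 A (p 2) m m') xs
      = (?B D (m 3) - (?h (?B D (m 3)) + ?h (?B D (m 3)))) xs" for xs
    by (simp add: algebra_simps)
  then have "?\<delta> (kappa4 A (p 2) m m') = 0"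
    unfolding scale_half_double [OF assms(1)] by (simp add: fun_eq_iff)
  moreover have "kappa4 A (p 2) m m' \<in> harrison_cochains A 4 (- 2)"
    unfolding kappa
    by (intro harrison_cochains_diff harrison_cochains_add harrison_cochains_scale P m m' D)
  ultimately show ?thesis
    using m'3 by (simp add: harrison_cocycles_def D_def)
qed

end
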